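(* The solutions of the equation $$\left\langle\begin{pmatrix}0&0\\0&-1\end{pmatrix}Y,N_Y\right\rangle=k_Y^{1/3}$$ for curves $Y$ in $\mathbb{R}^2$ are the following curves: (1) The lines $x=C$ (with $C$ any constant) and $y=0$. (2) The graph of a $T$-periodic function $y=y(x)$, given in one period by $$x-C_2=\begin{cases}\displaystyle\int_0^{y}\frac{1}{\sqrt{C_1-\frac12\xi^4}}\,d\xi,& -\sqrt[4]{2C_1}\le y\le\sqrt[4]{2C_1},\\[2mm] \displaystyle\frac T2-\int_0^{y}\frac{1}{\sqrt{C_1-\frac12\xi^4}}\,d\xi,& 0\le y\le\sqrt[4]{2C_1},\\[2mm] \displaystyle-\frac T2-\int_0^{y}\frac{1}{\sqrt{C_1-\frac12\xi^4}}\,d\xi,& -\sqrt[4]{2C_1}\le y\le0,\end{cases}$$ where $T=4\int_0^{\sqrt[4]{2C_1}}\frac{1}{\sqrt{C_1-\frac12\xi^4}}\,d\xi$, $C_1$ is a positive constant and $C_2$ is any constant.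
   Context: Points of $\mathbb{R}^2$ are written as $(x,y)$. Curves are smooth immersed curves. For a curve $Y=Y(u)$, put $\tau=Y_u/\|Y_u\|$, $N_Y=J\tau$ with $J=\begin{pmatrix}0&-1\\1&0\end{pmatrix}$ (unit normal), and $k_Y=\det(Y_u,Y_{uu})/\|Y_u\|^3$ (curvature with respect to $N_Y$). $\langle\cdot,\cdot\rangle$ is the Euclidean inner product and $k^{1/3}$ is the real (odd) cube root. Solutions are regarded as geometric curves (up to reparametrization), connected and maximally extended. In (2), the three lines of the formula describe three arcs (three pieces of the graph over a single period, $x-C_2\in[-T/4,T/4]$, $[T/4,T/2]$, $[-T/2,-T/4]$ respectively) whose union is the graph over $x-C_2\in[-T/2,T/2]$. *)

theory Defs
  imports "HOL-Analysis.Analysis"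
begin

abbreviation vderiv :: "(real \<Rightarrow> 'a::real_normed_vector) \<Rightarrow> real \<Rightarrow> 'a" where
  "vderiv f \<equiv> (\<lambda>u. vector_derivative f (at u))"

text \<open>Infinite differentiability. It is only used for open \<open>I\<close>, so that the iterated
  derivatives at points of \<open>I\<close> do not depend on the values of \<open>f\<close> outside \<open>I\<close>.\<close>

definition smooth_on :: "real set \<Rightarrow> (real \<Rightarrow> 'a::real_normed_vector) \<Rightarrow> bool" where
  "smooth_on I f \<longleftrightarrow> (\<forall>n. \<forall>u\<in>I. (vderiv ^^ n) f differentiable (at u))"

text \<open>A curve is a pair of a nonempty open interval \<open>I\<close> (possibly unbounded) and a
  map \<open>Y\<close>, of which only the values on \<open>I\<close> matter. A closed curve is represented by a
  periodic map on the whole real line.\<close>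

definition immersed_curve :: "real set \<Rightarrow> (real \<Rightarrow> real^2) \<Rightarrow> bool" where
  "immersed_curve I Y \<longleftrightarrow>
     open I \<and> connected I \<and> I \<noteq> {} \<and> smooth_on I Y \<and> (\<forall>u\<in>I. vderiv Y u \<noteq> 0)"

definition rotJ :: "real^2^2" where
  "rotJ = vector [vector [0, -1], vector [1, 0]]"

definition unit_tangent :: "(real \<Rightarrow> real^2) \<Rightarrow> real \<Rightarrow> real^2" where
  "unit_tangent Y u = vderiv Y u /\<^sub>R norm (vderiv Y u)"

definition unit_normal :: "(real \<Rightarrow> real^2) \<Rightarrow> real \<Rightarrow> real^2" where
  "unit_normal Y u = rotJ *v unit_tangent Y u"

text \<open>\<open>vector [p, q]\<close> has rows \<open>p\<close> and \<open>q\<close>; after transposition they are the columns.\<close>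

definition curvature :: "(real \<Rightarrow> real^2) \<Rightarrow> real \<Rightarrow> real" where
  "curvature Y u =
     det (transpose (vector [vderiv Y u, vderiv (vderiv Y) u] :: real^2^2))
       / norm (vderiv Y u) ^ 3"

text \<open>\<open>root 3\<close> is the odd real cube root, also for negative arguments.\<close>

definition solution_curve :: "real^2^2 \<Rightarrow> real set \<Rightarrow> (real \<Rightarrow> real^2) \<Rightarrow> bool" where
  "solution_curve A I Y \<longleftrightarrow> immersed_curve I Y \<and>
     (\<forall>u\<in>I. (A *v Y u) \<bullet> unit_normal Y u = root 3 (curvature Y u))"

text \<open>Changes of parameter may reverse the orientation. No regularity of \<open>Z\<close> is presupposed.\<close>

definition reparametrization ::
    "real set \<Rightarrow> (real \<Rightarrow> real^2) \<Rightarrow> real set \<Rightarrow> (real \<Rightarrow> real^2) \<Rightarrow> bool" where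
  "reparametrization I Y K Z \<longleftrightarrow> open I \<and> connected I \<and>
     (\<exists>\<phi>. smooth_on I \<phi> \<and> (\<forall>u\<in>I. vderiv \<phi> u \<noteq> (0::real)) \<and> bij_betw \<phi> I K \<and>
          (\<forall>u\<in>I. Y u = Z (\<phi> u)))"

text \<open>Maximally extended: the curve is not, even after a change of parameter, the
  restriction of a solution to a proper part of its parameter interval.\<close>

definition maximal_solution :: "real^2^2 \<Rightarrow> real set \<Rightarrow> (real \<Rightarrow> real^2) \<Rightarrow> bool" where
  "maximal_solution A I Y \<longleftrightarrow> solution_curve A I Y \<and>
     (\<forall>L Z K. solution_curve A L Z \<and> K \<subseteq> L \<and> reparametrization I Y K Z \<longrightarrow> K = L)"

definition amplitude :: "real \<Rightarrow> real" where
  "amplitude C1 = root 4 (2 * C1)"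

text \<open>The interval integral is signed, i.e. it is minus the integral over \<open>(y, 0)\<close>
  when \<open>y < 0\<close>; the integrand is singular but integrable at \<open>\<xi> = \<plusminus> amplitude C1\<close>.\<close>

definition arc_integral :: "real \<Rightarrow> real \<Rightarrow> real" where
  "arc_integral C1 y = (LBINT \<xi>=0..ereal y. 1 / sqrt (C1 - 1/2 * \<xi> ^ 4))"

definition period :: "real \<Rightarrow> real" where
  "period C1 = 4 * arc_integral C1 (amplitude C1)"

text \<open>The graph of \<open>y\<close> over one closed period, centred at \<open>C2\<close>, is the union of three arcs.\<close>

definition periodic_profile :: "real \<Rightarrow> real \<Rightarrow> (real \<Rightarrow> real) \<Rightarrow> bool" where
  "periodic_profile C1 C2 y \<longleftrightarrow>
     (let T = period C1; a = amplitude C1; F = arc_integral C1 in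
       (\<forall>x. y (x + T) = y x) \<and>
       {(x, y x) |x. x - C2 \<in> {-T/2..T/2}} =
         {(x, \<eta>). \<eta> \<in> {-a..a} \<and> x - C2 = F \<eta>} \<union>
         {(x, \<eta>). \<eta> \<in> {0..a} \<and> x - C2 = T/2 - F \<eta>} \<union>
         {(x, \<eta>). \<eta> \<in> {-a..0} \<and> x - C2 = -T/2 - F \<eta>})"

end

theory Submission
  imports Defs
begin

text \<open>In coordinates \<open>Y = (x, y)\<close> both sides of the equation carry the factor \<open>1 / |Y'|\<close>, and it
  becomes the polynomial equation \<open>x' y'' - y' x'' = - y^3 x'^3\<close> (\<open>curve_equation_iff\<close>). It has two
  kinds of solutions that do not mix: the squared cosine of the tangent angle satisfies a linear
  homogeneous equation, so \<open>x'\<close> vanishes everywhere or nowhere (\<open>tangent_stays_vertical\<close>).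

  If \<open>x'\<close> vanishes everywhere, the curve lies on a vertical line. Otherwise it is a graph over the
  \<open>x\<close>-axis and the equation says \<open>w'' = - w^3\<close> for the graph function: the oscillator with a cubic
  restoring force. The theory of this equation consists of two facts. Its solutions exist
  globally: \<open>w = a sin \<theta>\<close>, where the angle \<open>\<theta>\<close> is the inverse function of
  \<open>\<integral> sqrt 2 / (a sqrt (1 + sin\<^sup>2 t)) dt\<close>, and every nonzero initial value belongs to a translate of
  one of them (\<open>velocity_DERIV\<close>, \<open>oscillation_phase\<close>). And they are unique, by a Gronwall
  argument carried out in the parameter of the curve (\<open>graph_unique\<close>).

  The substitution \<open>\<xi> = a sin t\<close> transforms the integral of the profile into the integral that
  defines the angle, and the symmetries of the sine produce the three arcs of a period. So the
  profile exists, is unique and is the oscillation (\<open>periodic_profile_iff\<close>).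

  A maximal solution must be the whole line or graph, because the whole line or graph is itself a
  solution extending it. Conversely a whole line or graph cannot be extended: the tangent of any
  extension is of the same type throughout, so the coordinate that parametrizes the curve stays
  injective on the extension, but it already takes every real value on the curve
  (\<open>maximal_if_coordinate_onto\<close>).\<close>

section \<open>Smooth functions on an open interval\<close>

lemma smooth_on_unfold:
  "smooth_on I f \<longleftrightarrow> (\<forall>u\<in>I. f differentiable at u) \<and> smooth_on I (vderiv f)"
proof -
  have "(\<forall>n. P n) \<longleftrightarrow> P 0 \<and> (\<forall>n. P (Suc n))" for P
    by (metis not0_implies_Suc)
  from this[of "\<lambda>n. \<forall>u\<in>I. (vderiv ^^ n) f differentiable (at u)"] show ?thesis
    unfolding smooth_on_def by (simp add: funpow_Suc_right del: funpow.simps(2))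
qed

lemma smooth_on_has_vector_derivative:
  assumes "smooth_on I f" "u \<in> I"
  shows "(f has_vector_derivative vderiv f u) (at u)"
  using assms by (simp add: smooth_on_unfold[of I f] flip: vector_derivative_works)

lemma smooth_on_DERIV:
  fixes f :: "real \<Rightarrow> real"
  assumes "smooth_on I f" "u \<in> I"
  shows "(f has_real_derivative vderiv f u) (at u)"
  using smooth_on_has_vector_derivative[OF assms]
  by (simp add: has_real_derivative_iff_has_vector_derivative)

lemma smooth_on_vderiv: "smooth_on I f \<Longrightarrow> smooth_on I (vderiv f)"
  by (rule conjunct2[OF iffD1[OF smooth_on_unfold]])

text \<open>A family of functions closed under differentiation consists of smooth functions. The
  closure is only required on \<open>I\<close>, because the derivatives occurring in practice are known there
  only, whereas the iterates of \<open>vderiv\<close> are global functions; openness of \<open>I\<close> bridges the gap.\<close>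

lemma smooth_on_coinduct:
  assumes "open I" "P f"
    and step: "\<And>f. P f \<Longrightarrow> \<exists>g. P g \<and> (\<forall>u\<in>I. (f has_vector_derivative g u) (at u))"
  shows "smooth_on I f"
proof -
  have iterate: "\<exists>g. P g \<and> (\<forall>u\<in>I. (vderiv ^^ n) f u = g u)" for n
  proof (induction n)
    case 0
    then show ?case using \<open>P f\<close> by auto
  next
    case (Suc n)
    then obtain g where g: "P g" "\<forall>u\<in>I. (vderiv ^^ n) f u = g u" by (elim exE conjE)
    obtain h where h: "P h" "\<forall>u\<in>I. (g has_vector_derivative h u) (at u)"
      using step[OF g(1)] by (elim exE conjE)
    have "((vderiv ^^ n) f has_vector_derivative h u) (at u)" if "u \<in> I" for u
      by (rule has_vector_derivative_transform_within_open[of g _ _ I])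
        (use that g h \<open>open I\<close> in auto)
    then have "\<forall>u\<in>I. (vderiv ^^ Suc n) f u = h u"
      by (simp add: vector_derivative_at)
    then show ?case using h(1) by blast
  qed
  have "(vderiv ^^ n) f differentiable at u" if "u \<in> I" for n u
  proof -
    obtain g where g: "P g" "\<forall>u\<in>I. (vderiv ^^ n) f u = g u"
      using iterate[of n] by (elim exE conjE)
    obtain h where h: "\<forall>u\<in>I. (g has_vector_derivative h u) (at u)"
      using step[OF g(1)] by (elim exE conjE)
    have "((vderiv ^^ n) f has_vector_derivative h u) (at u)"
      by (rule has_vector_derivative_transform_within_open[of g _ _ I])
        (use that g h \<open>open I\<close> in auto)
    then show ?thesis by (rule differentiableI_vector)
  qed
  then show ?thesis by (simp add: smooth_on_def)
qed

lemma smooth_on_cong: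
  assumes "open I" "smooth_on I f" "\<And>u. u \<in> I \<Longrightarrow> g u = f u"
  shows "smooth_on I g"
proof (rule smooth_on_coinduct[OF \<open>open I\<close>, where P = "\<lambda>g. \<exists>f. smooth_on I f \<and> (\<forall>u\<in>I. g u = f u)"])
  fix g assume "\<exists>f. smooth_on I f \<and> (\<forall>u\<in>I. g u = f u)"
  then obtain f where f: "smooth_on I f" "\<forall>u\<in>I. g u = f u" by (elim exE conjE)
  have D: "\<forall>u\<in>I. (g has_vector_derivative vderiv f u) (at u)"
  proof
    fix u assume "u \<in> I"
    show "(g has_vector_derivative vderiv f u) (at u)"
      by (rule has_vector_derivative_transform_within_open
          [OF smooth_on_has_vector_derivative[OF f(1) \<open>u \<in> I\<close>] \<open>open I\<close> \<open>u \<in> I\<close>])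
        (simp add: f(2))
  qed
  show "\<exists>h. (\<exists>f. smooth_on I f \<and> (\<forall>u\<in>I. h u = f u)) \<and>
      (\<forall>u\<in>I. (g has_vector_derivative h u) (at u))"
  proof (rule exI[of _ "vderiv f"], rule conjI[OF _ D])
    show "\<exists>h. smooth_on I h \<and> (\<forall>u\<in>I. vderiv f u = h u)"
      by (rule exI[of _ "vderiv f"]) (simp add: smooth_on_vderiv[OF f(1)])
  qed
next
  show "\<exists>f. smooth_on I f \<and> (\<forall>u\<in>I. g u = f u)"
    using assms(2,3) by blast
qed

text \<open>Solutions of polynomial differential equations are smooth because the derivative of
  any polynomial in the unknowns is again a polynomial in them. The algebra generated by a set of
  functions makes this usable with the coinduction rule.\<close>

inductive_set algebra_of :: "(real \<Rightarrow> real) set \<Rightarrow> (real \<Rightarrow> real) set" for S where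
  gen: "f \<in> S \<Longrightarrow> f \<in> algebra_of S"
| const: "(\<lambda>u. c) \<in> algebra_of S"
| add: "f \<in> algebra_of S \<Longrightarrow> g \<in> algebra_of S \<Longrightarrow> (\<lambda>u. f u + g u) \<in> algebra_of S"
| mult: "f \<in> algebra_of S \<Longrightarrow> g \<in> algebra_of S \<Longrightarrow> (\<lambda>u. f u * g u) \<in> algebra_of S"

text \<open>By the sum and product rules it suffices that the generators have their derivatives in
  the algebra.\<close>

lemma smooth_on_algebra_of:
  assumes "open I" and f: "f \<in> algebra_of S"
    and S: "\<And>f. f \<in> S \<Longrightarrow> \<exists>g\<in>algebra_of S. \<forall>u\<in>I. (f has_real_derivative g u) (at u)"
  shows "smooth_on I f"
proof (rule smooth_on_coinduct[OF \<open>open I\<close>, where P = "\<lambda>f. f \<in> algebra_of S"])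
  fix f assume "f \<in> algebra_of S"
  then have "\<exists>g\<in>algebra_of S. \<forall>u\<in>I. (f has_real_derivative g u) (at u)"
  proof induction
    case (gen f)
    then show ?case by (rule S)
  next
    case (const c)
    have "\<forall>u\<in>I. ((\<lambda>u. c) has_real_derivative 0) (at u)" by simp
    then show ?case by (rule bexI[OF _ algebra_of.const])
  next
    case (add f g)
    obtain f' where f': "f' \<in> algebra_of S" "\<forall>u\<in>I. (f has_real_derivative f' u) (at u)"
      using add.IH(1) by (elim bexE)
    obtain g' where g': "g' \<in> algebra_of S" "\<forall>u\<in>I. (g has_real_derivative g' u) (at u)"
      using add.IH(2) by (elim bexE)
    have "\<forall>u\<in>I. ((\<lambda>u. f u + g u) has_real_derivative f' u + g' u) (at u)"
      using f'(2) g'(2) by (simp add: DERIV_add)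
    then show ?case
      by (rule bexI[OF _ algebra_of.add[OF f'(1) g'(1)]])
  next
    case (mult f g)
    obtain f' where f': "f' \<in> algebra_of S" "\<forall>u\<in>I. (f has_real_derivative f' u) (at u)"
      using mult.IH(1) by (elim bexE)
    obtain g' where g': "g' \<in> algebra_of S" "\<forall>u\<in>I. (g has_real_derivative g' u) (at u)"
      using mult.IH(2) by (elim bexE)
    have "\<forall>u\<in>I. ((\<lambda>u. f u * g u) has_real_derivative f' u * g u + g' u * f u) (at u)"
      using f'(2) g'(2) by (simp add: DERIV_mult)
    then show ?case
      by (rule bexI[OF _ algebra_of.add[OF algebra_of.mult[OF f'(1) mult.hyps(2)]
            algebra_of.mult[OF g'(1) mult.hyps(1)]]])
  qed
  then show "\<exists>g. g \<in> algebra_of S \<and> (\<forall>u\<in>I. (f has_vector_derivative g u) (at u))"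
    by (auto simp: has_real_derivative_iff_has_vector_derivative)
qed (rule f)

lemma smooth_on_const:
  fixes c :: real
  assumes "open I"
  shows "smooth_on I (\<lambda>u. c)"
  by (rule smooth_on_algebra_of[OF assms algebra_of.const[of _ "{}"]]) simp

lemma smooth_on_ident:
  assumes "open I"
  shows "smooth_on I (\<lambda>u. u::real)"
proof (rule smooth_on_algebra_of[OF assms algebra_of.gen[OF singletonI]])
  fix f :: "real \<Rightarrow> real" assume "f \<in> {\<lambda>u. u}"
  then have "\<forall>u\<in>I. (f has_real_derivative 1) (at u)" by simp
  then show "\<exists>g\<in>algebra_of {\<lambda>u. u}. \<forall>u\<in>I. (f has_real_derivative g u) (at u)"
    by (rule bexI[OF _ algebra_of.const])
qed

section \<open>The equation in coordinates\<close>

lemma has_vector_derivative_real2_iff: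
  fixes Y :: "real \<Rightarrow> real^2"
  shows "(Y has_vector_derivative D) (at u) \<longleftrightarrow>
    ((\<lambda>t. Y t $ 1) has_real_derivative D $ 1) (at u) \<and>
    ((\<lambda>t. Y t $ 2) has_real_derivative D $ 2) (at u)" (is "_ \<longleftrightarrow> ?R")
proof
  assume "(Y has_vector_derivative D) (at u)"
  then have "((\<lambda>t. Y t $ i) has_vector_derivative D $ i) (at u)" for i
    by (rule bounded_linear.has_vector_derivative[OF bounded_linear_vec_nth])
  then show ?R by (simp add: has_real_derivative_iff_has_vector_derivative)
next
  have decomp: "v = (v $ 1) *\<^sub>R axis 1 1 + (v $ 2) *\<^sub>R axis 2 1" for v :: "real^2"
    by (simp add: vec_eq_iff forall_2 axis_def)
  assume R: ?R
  have "((\<lambda>t. (Y t $ 1) *\<^sub>R axis 1 1 + (Y t $ 2) *\<^sub>R axis 2 1 :: real^2) has_vector_derivative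
      (D $ 1) *\<^sub>R axis 1 1 + (D $ 2) *\<^sub>R axis 2 1) (at u)"
    using R by (auto intro!: derivative_eq_intros simp: has_real_derivative_iff_has_vector_derivative
       intro: bounded_linear.has_vector_derivative[OF bounded_linear_scaleR_left])
  then show "(Y has_vector_derivative D) (at u)"
    by (simp flip: decomp)
qed

lemma smooth_on_real2_iff:
  fixes Y :: "real \<Rightarrow> real^2"
  assumes "open I"
  shows "smooth_on I Y \<longleftrightarrow> smooth_on I (\<lambda>t. Y t $ 1) \<and> smooth_on I (\<lambda>t. Y t $ 2)"
proof (intro iffI conjI)
  assume Y: "smooth_on I Y"
  have *: "smooth_on I (\<lambda>t. Y t $ i)" for i
  proof (rule smooth_on_coinduct[OF assms,
        where P = "\<lambda>f. \<exists>Y::real \<Rightarrow> real^2. smooth_on I Y \<and> f = (\<lambda>t. Y t $ i)"])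
    fix f assume "\<exists>Y::real \<Rightarrow> real^2. smooth_on I Y \<and> f = (\<lambda>t. Y t $ i)"
    then obtain Y :: "real \<Rightarrow> real^2" where Y: "smooth_on I Y" "f = (\<lambda>t. Y t $ i)" by blast
    have "(f has_vector_derivative vderiv Y u $ i) (at u)" if "u \<in> I" for u
      unfolding Y(2) by (rule bounded_linear.has_vector_derivative
          [OF bounded_linear_vec_nth smooth_on_has_vector_derivative[OF Y(1) that]])
    then show "\<exists>g. (\<exists>Y::real \<Rightarrow> real^2. smooth_on I Y \<and> g = (\<lambda>t. Y t $ i)) \<and>
        (\<forall>u\<in>I. (f has_vector_derivative g u) (at u))"
      using smooth_on_vderiv[OF Y(1)] by blast
  qed (use Y in auto)
  show "smooth_on I (\<lambda>t. Y t $ 1)" "smooth_on I (\<lambda>t. Y t $ 2)" by (rule *)+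
next
  assume "smooth_on I (\<lambda>t. Y t $ 1) \<and> smooth_on I (\<lambda>t. Y t $ 2)"
  then show "smooth_on I Y"
  proof (intro smooth_on_coinduct[OF assms,
        where P = "\<lambda>Y. smooth_on I (\<lambda>t. Y t $ 1) \<and> smooth_on I (\<lambda>t. Y t $ (2::2))"])
    fix Y :: "real \<Rightarrow> real^2"
    let ?D = "\<lambda>u. vector [vderiv (\<lambda>t. Y t $ 1) u, vderiv (\<lambda>t. Y t $ 2) u] :: real^2"
    assume Y: "smooth_on I (\<lambda>t. Y t $ 1) \<and> smooth_on I (\<lambda>t. Y t $ 2)"
    have "\<forall>u\<in>I. (Y has_vector_derivative ?D u) (at u)"
      unfolding has_vector_derivative_real2_iff vector_2 using Y smooth_on_DERIV by blast
    moreover have "smooth_on I (\<lambda>t. ?D t $ 1) \<and> smooth_on I (\<lambda>t. ?D t $ 2)"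
      using Y by (simp add: smooth_on_vderiv)
    ultimately show "\<exists>g. (smooth_on I (\<lambda>t. g t $ 1) \<and> smooth_on I (\<lambda>t. g t $ 2)) \<and>
        (\<forall>u\<in>I. (Y has_vector_derivative g u) (at u))"
      by (intro exI[of _ ?D] conjI) simp_all
  qed
qed

lemma smooth_on_real2_vderiv:
  fixes Y :: "real \<Rightarrow> real^2"
  assumes "open I" "smooth_on I Y" "u \<in> I"
  shows "vderiv Y u $ 1 = vderiv (\<lambda>t. Y t $ 1) u" "vderiv Y u $ 2 = vderiv (\<lambda>t. Y t $ 2) u"
  using smooth_on_has_vector_derivative[OF assms(2,3), unfolded has_vector_derivative_real2_iff
      has_real_derivative_iff_has_vector_derivative]
  by (metis vector_derivative_at)+

lemma smooth_on_real2_vderiv2: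
  fixes Y :: "real \<Rightarrow> real^2"
  assumes "open I" "smooth_on I Y" "u \<in> I"
  shows "vderiv (vderiv Y) u $ 1 = vderiv (vderiv (\<lambda>t. Y t $ 1)) u"
    "vderiv (vderiv Y) u $ 2 = vderiv (vderiv (\<lambda>t. Y t $ 2)) u"
proof -
  have D: "(vderiv Y has_vector_derivative vderiv (vderiv Y) u) (at u)"
    by (rule smooth_on_has_vector_derivative[OF smooth_on_vderiv[OF assms(2)] assms(3)])
  have *: "(vderiv (\<lambda>t. Y t $ i) has_vector_derivative vderiv (vderiv Y) u $ i) (at u)"
    if "\<And>t. t \<in> I \<Longrightarrow> vderiv Y t $ i = vderiv (\<lambda>t. Y t $ i) t" for i
  proof (rule has_vector_derivative_transform_within_open[of "\<lambda>t. vderiv Y t $ i" _ _ I])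
    show "((\<lambda>t. vderiv Y t $ i) has_vector_derivative vderiv (vderiv Y) u $ i) (at u)"
      by (rule bounded_linear.has_vector_derivative[OF bounded_linear_vec_nth D])
  qed (use assms that in simp_all)
  show "vderiv (vderiv Y) u $ 1 = vderiv (vderiv (\<lambda>t. Y t $ 1)) u"
    using *[OF smooth_on_real2_vderiv(1)[OF assms(1,2)]] by (simp add: vector_derivative_at)
  show "vderiv (vderiv Y) u $ 2 = vderiv (vderiv (\<lambda>t. Y t $ 2)) u"
    using *[OF smooth_on_real2_vderiv(2)[OF assms(1,2)]] by (simp add: vector_derivative_at)
qed

abbreviation height_matrix :: "real^2^2" where
  "height_matrix \<equiv> vector [vector [0, 0], vector [0, -1]]"

text \<open>The inner product equals \<open>-y x' / |Y'|\<close>, and since the curvature is a determinant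
  divided by \<open>|Y'|\<close> to the third power, its cube root carries the same denominator \<open>|Y'|\<close>. Hence
  the denominators cancel and cubing leaves a polynomial equation.\<close>

lemma curve_equation_iff:
  fixes Y :: "real \<Rightarrow> real^2"
  assumes "vderiv Y u \<noteq> 0"
  defines "x1 \<equiv> vderiv Y u $ 1" and "y1 \<equiv> vderiv Y u $ 2"
    and "x2 \<equiv> vderiv (vderiv Y) u $ 1" and "y2 \<equiv> vderiv (vderiv Y) u $ 2"
  shows "(height_matrix *v Y u) \<bullet> unit_normal Y u = root 3 (curvature Y u)
    \<longleftrightarrow> x1 * y2 - y1 * x2 = - ((Y u $ 2) ^ 3 * x1 ^ 3)"
proof -
  let ?n = "norm (vderiv Y u)"
  have n: "?n > 0" using assms(1) by simp
  have lhs: "(height_matrix *v Y u) \<bullet> unit_normal Y u = - (Y u $ 2) * x1 / ?n"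
    by (simp add: unit_normal_def unit_tangent_def rotJ_def inner_vec_def sum_2
        matrix_vector_mult_def x1_def divide_inverse algebra_simps)
  have curv: "curvature Y u = (x1 * y2 - y1 * x2) / ?n ^ 3"
    by (simp add: curvature_def det_2 transpose_def x1_def x2_def y1_def y2_def algebra_simps)
  have "root 3 (curvature Y u) = root 3 (x1 * y2 - y1 * x2) / ?n"
    using n by (simp add: curv real_root_divide odd_real_root_power_cancel)
  then have "(height_matrix *v Y u) \<bullet> unit_normal Y u = root 3 (curvature Y u)
      \<longleftrightarrow> - (Y u $ 2) * x1 = root 3 (x1 * y2 - y1 * x2)"
    using n by (simp add: lhs field_simps)
  also have "\<dots> \<longleftrightarrow> (- (Y u $ 2) * x1) ^ 3 = x1 * y2 - y1 * x2"
    by (metis odd_numeral odd_real_root_pow odd_real_root_power_cancel)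
  finally show ?thesis by (auto simp: power_mult_distrib)
qed


lemma solution_curve_iff:
  "solution_curve height_matrix I Y \<longleftrightarrow>
    open I \<and> connected I \<and> I \<noteq> {} \<and> smooth_on I (\<lambda>t. Y t $ 1) \<and> smooth_on I (\<lambda>t. Y t $ 2) \<and>
    (\<forall>u\<in>I. (vderiv (\<lambda>t. Y t $ 1) u \<noteq> 0 \<or> vderiv (\<lambda>t. Y t $ 2) u \<noteq> 0) \<and>
      vderiv (\<lambda>t. Y t $ 1) u * vderiv (vderiv (\<lambda>t. Y t $ 2)) u
        - vderiv (\<lambda>t. Y t $ 2) u * vderiv (vderiv (\<lambda>t. Y t $ 1)) u
      = - ((Y u $ 2) ^ 3 * vderiv (\<lambda>t. Y t $ 1) u ^ 3))"
proof (cases "open I \<and> smooth_on I Y")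
  case True
  have nz: "vderiv Y u \<noteq> 0 \<longleftrightarrow> vderiv (\<lambda>t. Y t $ 1) u \<noteq> 0 \<or> vderiv (\<lambda>t. Y t $ 2) u \<noteq> 0"
    if "u \<in> I" for u
    using smooth_on_real2_vderiv[of I Y u] True that by (simp add: vec_eq_iff forall_2)
  have eq: "(height_matrix *v Y u) \<bullet> unit_normal Y u = root 3 (curvature Y u)
    \<longleftrightarrow> vderiv (\<lambda>t. Y t $ 1) u * vderiv (vderiv (\<lambda>t. Y t $ 2)) u
        - vderiv (\<lambda>t. Y t $ 2) u * vderiv (vderiv (\<lambda>t. Y t $ 1)) u
      = - ((Y u $ 2) ^ 3 * vderiv (\<lambda>t. Y t $ 1) u ^ 3)"
    if "u \<in> I" "vderiv Y u \<noteq> 0" for u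
    using curve_equation_iff[OF that(2)] smooth_on_real2_vderiv[of I Y u]
      smooth_on_real2_vderiv2[of I Y u] True that(1) by simp
  have "solution_curve height_matrix I Y \<longleftrightarrow> open I \<and> connected I \<and> I \<noteq> {} \<and>
      (\<forall>u\<in>I. vderiv Y u \<noteq> 0 \<and>
        (height_matrix *v Y u) \<bullet> unit_normal Y u = root 3 (curvature Y u))"
    using True unfolding solution_curve_def immersed_curve_def by blast
  also have "\<dots> \<longleftrightarrow> open I \<and> connected I \<and> I \<noteq> {} \<and>
      (\<forall>u\<in>I. (vderiv (\<lambda>t. Y t $ 1) u \<noteq> 0 \<or> vderiv (\<lambda>t. Y t $ 2) u \<noteq> 0) \<and>
        vderiv (\<lambda>t. Y t $ 1) u * vderiv (vderiv (\<lambda>t. Y t $ 2)) u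
          - vderiv (\<lambda>t. Y t $ 2) u * vderiv (vderiv (\<lambda>t. Y t $ 1)) u
        = - ((Y u $ 2) ^ 3 * vderiv (\<lambda>t. Y t $ 1) u ^ 3))"
    by (intro conj_cong refl ball_cong nz eq) (use nz in blast)+
  finally have *: "solution_curve height_matrix I Y \<longleftrightarrow> \<dots>" .
  have "smooth_on I (\<lambda>t. Y t $ 1)" "smooth_on I (\<lambda>t. Y t $ 2)"
    using iffD1[OF smooth_on_real2_iff[OF conjunct1[OF True]] conjunct2[OF True]]
    by (rule conjunct1, rule conjunct2)
  then show ?thesis
    using * by blast
next
  case False
  then have "\<not> solution_curve height_matrix I Y"
    unfolding solution_curve_def immersed_curve_def by blast
  moreover have "\<not> (open I \<and> smooth_on I (\<lambda>t. Y t $ 1) \<and> smooth_on I (\<lambda>t. Y t $ 2))"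
    using False smooth_on_real2_iff[of I Y] by blast
  ultimately show ?thesis by blast
qed

section \<open>Gronwall estimates\<close>

text \<open>With \<open>M\<close> an upper bound of \<open>K\<close> on the compact interval from \<open>a\<close> to \<open>b\<close>, the function
  \<open>D u * exp (- M * u)\<close> decreases from zero, so \<open>D\<close> cannot become positive.\<close>

lemma gronwall_zero_forward:
  fixes D K :: "real \<Rightarrow> real"
  assumes I: "is_interval I"
    and D: "\<And>u. u \<in> I \<Longrightarrow> (D has_real_derivative D' u) (at u)"
    and le: "\<And>u. u \<in> I \<Longrightarrow> \<bar>D' u\<bar> \<le> K u * D u"
    and nonneg: "\<And>u. u \<in> I \<Longrightarrow> 0 \<le> D u"
    and K: "continuous_on I K"
    and "D a = 0" "a \<in> I" "b \<in> I" "a \<le> b"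
  shows "D b = 0"
proof -
  have sub: "{a..b} \<subseteq> I"
    using I \<open>a \<in> I\<close> \<open>b \<in> I\<close> by (meson atLeastAtMost_iff mem_is_interval_1_I subsetI)
  obtain M where M: "\<And>u. u \<in> {a..b} \<Longrightarrow> K u \<le> M"
    using continuous_attains_sup[OF compact_Icc _ continuous_on_subset[OF K sub]] \<open>a \<le> b\<close>
    by (metis atLeastatMost_empty_iff2)
  have "D b * exp (- M * b) \<le> D a * exp (- M * a)"
  proof (rule DERIV_nonpos_imp_nonincreasing[OF \<open>a \<le> b\<close>])
    fix u assume u: "a \<le> u" "u \<le> b"
    then have uI: "u \<in> I" using sub by auto
    have "D' u \<le> M * D u"
      using le[OF uI] M[of u] nonneg[OF uI] u mult_right_mono[of "K u" M "D u"] by auto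
    then have "(D' u - M * D u) * exp (- M * u) \<le> 0"
      by (simp add: mult_nonpos_nonneg)
    moreover have "((\<lambda>u. D u * exp (- M * u)) has_real_derivative (D' u - M * D u) * exp (- M * u)) (at u)"
      by (rule derivative_eq_intros D uI refl)+ (simp add: algebra_simps)
    ultimately show "\<exists>y. ((\<lambda>u. D u * exp (- M * u)) has_real_derivative y) (at u) \<and> y \<le> 0"
      by blast
  qed
  then have "D b \<le> 0"
    using \<open>D a = 0\<close> by (simp add: mult_le_0_iff)
  with nonneg[OF \<open>b \<in> I\<close>] show ?thesis by simp
qed

text \<open>The form in which uniqueness is used below: \<open>D\<close> measures a squared deviation, and the
  two-sided bound on its derivative makes the set of its zeros invariant in both directions, the
  backward one by reflecting the parameter.\<close>

lemma gronwall_zero: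
  fixes D K :: "real \<Rightarrow> real"
  assumes I: "is_interval I"
    and D: "\<And>u. u \<in> I \<Longrightarrow> (D has_real_derivative D' u) (at u)"
    and le: "\<And>u. u \<in> I \<Longrightarrow> \<bar>D' u\<bar> \<le> K u * D u"
    and nonneg: "\<And>u. u \<in> I \<Longrightarrow> 0 \<le> D u"
    and K: "continuous_on I K"
    and a: "D a = 0" "a \<in> I" and b: "b \<in> I"
  shows "D b = 0"
proof (cases "a \<le> b")
  case True
  then show ?thesis using gronwall_zero_forward[OF I D le nonneg K a b True] by simp
next
  case False
  have "(\<lambda>u. D (- u)) (- b) = 0"
  proof (rule gronwall_zero_forward[where D = "\<lambda>u. D (- u)" and a = "- a" and b = "- b" and I = "uminus ` I" and K = "\<lambda>u. K (- u)"
        and D' = "\<lambda>u. - D' (- u)"])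
    show "is_interval (uminus ` I)" using I by (simp only: is_interval_uminus)
    show "((\<lambda>u. D (- u)) has_real_derivative - D' (- u)) (at u)" if "u \<in> uminus ` I" for u
    proof -
      have "- u \<in> I" using that by force
      show ?thesis
        using DERIV_chain[OF D[OF \<open>- u \<in> I\<close>] DERIV_minus[OF DERIV_ident]]
        by (simp add: o_def)
    qed
    show "continuous_on (uminus ` I) (\<lambda>u. K (- u))"
      by (rule continuous_on_compose2[OF K continuous_on_minus[OF continuous_on_id]]) auto
    show "\<bar>- D' (- u)\<bar> \<le> K (- u) * D (- u)" "0 \<le> D (- u)"
      if "u \<in> uminus ` I" for u
      using that le[of "- u"] nonneg[of "- u"] by auto
  qed (use a b False in auto)
  then show ?thesis by simp
qed

lemma inj_on_if_deriv_nonzero: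
  fixes f :: "real \<Rightarrow> real"
  assumes I: "is_interval I"
    and f: "\<And>u. u \<in> I \<Longrightarrow> (f has_real_derivative f' u) (at u)" "\<And>u. u \<in> I \<Longrightarrow> f' u \<noteq> 0"
  shows "inj_on f I"
proof (rule linorder_inj_onI)
  fix a b assume ab: "a < b" "a \<in> I" "b \<in> I"
  have sub: "{a..b} \<subseteq> I"
    using I ab(2,3) by (meson atLeastAtMost_iff mem_is_interval_1_I subsetI)
  obtain z where "a < z" "z < b" "f b - f a = (b - a) * f' z"
    using MVT2[OF \<open>a < b\<close>, of f f'] f(1) sub by (metis atLeastAtMost_iff subsetD)
  moreover have "z \<in> I" using sub \<open>a < z\<close> \<open>z < b\<close> by auto
  ultimately show "f a \<noteq> f b" using f(2)[of z] ab by auto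
qed auto

section \<open>Curves solving the equation\<close>

lemma solution_curve_DERIV:
  assumes "solution_curve height_matrix I Y" "u \<in> I"
  shows "((\<lambda>t. Y t $ 1) has_real_derivative vderiv (\<lambda>t. Y t $ 1) u) (at u)"
    "((\<lambda>t. Y t $ 2) has_real_derivative vderiv (\<lambda>t. Y t $ 2) u) (at u)"
    "(vderiv (\<lambda>t. Y t $ 1) has_real_derivative vderiv (vderiv (\<lambda>t. Y t $ 1)) u) (at u)"
    "(vderiv (\<lambda>t. Y t $ 2) has_real_derivative vderiv (vderiv (\<lambda>t. Y t $ 2)) u) (at u)"
proof -
  have "smooth_on I (\<lambda>t. Y t $ 1)" "smooth_on I (\<lambda>t. Y t $ 2)"
    using assms(1) unfolding solution_curve_iff by blast+
  note s = this smooth_on_vderiv[OF this(1)] smooth_on_vderiv[OF this(2)]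
  show "((\<lambda>t. Y t $ 1) has_real_derivative vderiv (\<lambda>t. Y t $ 1) u) (at u)"
    by (rule smooth_on_DERIV[OF s(1) assms(2)])
  show "((\<lambda>t. Y t $ 2) has_real_derivative vderiv (\<lambda>t. Y t $ 2) u) (at u)"
    by (rule smooth_on_DERIV[OF s(2) assms(2)])
  show "(vderiv (\<lambda>t. Y t $ 1) has_real_derivative vderiv (vderiv (\<lambda>t. Y t $ 1)) u) (at u)"
    by (rule smooth_on_DERIV[OF s(3) assms(2)])
  show "(vderiv (\<lambda>t. Y t $ 2) has_real_derivative vderiv (vderiv (\<lambda>t. Y t $ 2)) u) (at u)"
    by (rule smooth_on_DERIV[OF s(4) assms(2)])
qed

lemma solution_curve_interval:
  assumes "solution_curve height_matrix I Y"
  shows "open I" "is_interval I" "I \<noteq> {}"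
  using assms unfolding solution_curve_iff is_interval_connected_1 by blast+

lemma solution_curve_ODE:
  assumes "solution_curve height_matrix I Y" "u \<in> I"
  shows "vderiv (\<lambda>t. Y t $ 1) u \<noteq> 0 \<or> vderiv (\<lambda>t. Y t $ 2) u \<noteq> 0"
    "vderiv (\<lambda>t. Y t $ 1) u * vderiv (vderiv (\<lambda>t. Y t $ 2)) u
        - vderiv (\<lambda>t. Y t $ 2) u * vderiv (vderiv (\<lambda>t. Y t $ 1)) u
      = - ((Y u $ 2) ^ 3 * vderiv (\<lambda>t. Y t $ 1) u ^ 3)"
proof -
  have "\<forall>u\<in>I. (vderiv (\<lambda>t. Y t $ 1) u \<noteq> 0 \<or> vderiv (\<lambda>t. Y t $ 2) u \<noteq> 0) \<and>
      vderiv (\<lambda>t. Y t $ 1) u * vderiv (vderiv (\<lambda>t. Y t $ 2)) u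
        - vderiv (\<lambda>t. Y t $ 2) u * vderiv (vderiv (\<lambda>t. Y t $ 1)) u
      = - ((Y u $ 2) ^ 3 * vderiv (\<lambda>t. Y t $ 1) u ^ 3)"
    using assms(1) unfolding solution_curve_iff by (elim conjE)
  from bspec[OF this assms(2)] show "vderiv (\<lambda>t. Y t $ 1) u \<noteq> 0 \<or> vderiv (\<lambda>t. Y t $ 2) u \<noteq> 0"
    "vderiv (\<lambda>t. Y t $ 1) u * vderiv (vderiv (\<lambda>t. Y t $ 2)) u
        - vderiv (\<lambda>t. Y t $ 2) u * vderiv (vderiv (\<lambda>t. Y t $ 1)) u
      = - ((Y u $ 2) ^ 3 * vderiv (\<lambda>t. Y t $ 1) u ^ 3)"
    by (rule conjunct1, rule conjunct2)
qed

text \<open>Second derivatives need \<open>f1\<close> to be the derivative near \<open>u\<close> and not only at \<open>u\<close>, which is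
  where openness enters.\<close>

lemma vderiv_on_open:
  fixes f :: "real \<Rightarrow> real"
  assumes "open I" "\<And>u. u \<in> I \<Longrightarrow> (f has_real_derivative f1 u) (at u)" "u \<in> I"
    "(f1 has_real_derivative f2) (at u)"
  shows "vderiv f u = f1 u" "vderiv (vderiv f) u = f2"
proof -
  have eq: "vderiv f t = f1 t" if "t \<in> I" for t
    using assms(2)[OF that]
    by (simp add: has_real_derivative_iff_has_vector_derivative vector_derivative_at)
  then show "vderiv f u = f1 u" using assms(3) by blast
  have "(vderiv f has_vector_derivative f2) (at u)"
    by (rule has_vector_derivative_transform_within_open[of f1 _ _ I])
      (use assms(1,3,4) eq in \<open>auto simp: has_real_derivative_iff_has_vector_derivative\<close>)
  then show "vderiv (vderiv f) u = f2" by (rule vector_derivative_at)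
qed

lemma solution_curveI:
  assumes "open I" "connected I" "I \<noteq> {}"
    and "smooth_on I (\<lambda>t. Y t $ 1)" "smooth_on I (\<lambda>t. Y t $ 2)"
    and x: "\<And>u. u \<in> I \<Longrightarrow> ((\<lambda>t. Y t $ 1) has_real_derivative x1 u) (at u)"
      "\<And>u. u \<in> I \<Longrightarrow> (x1 has_real_derivative x2 u) (at u)"
    and y: "\<And>u. u \<in> I \<Longrightarrow> ((\<lambda>t. Y t $ 2) has_real_derivative y1 u) (at u)"
      "\<And>u. u \<in> I \<Longrightarrow> (y1 has_real_derivative y2 u) (at u)"
    and ODE: "\<And>u. u \<in> I \<Longrightarrow> x1 u \<noteq> 0 \<or> y1 u \<noteq> 0"
      "\<And>u. u \<in> I \<Longrightarrow> x1 u * y2 u - y1 u * x2 u = - ((Y u $ 2) ^ 3 * x1 u ^ 3)"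
  shows "solution_curve height_matrix I Y"
  unfolding solution_curve_iff
proof (intro conjI ballI)
  fix u assume u: "u \<in> I"
  have D: "vderiv (\<lambda>t. Y t $ 1) u = x1 u" "vderiv (\<lambda>t. Y t $ 2) u = y1 u"
      "vderiv (vderiv (\<lambda>t. Y t $ 1)) u = x2 u" "vderiv (vderiv (\<lambda>t. Y t $ 2)) u = y2 u"
    using vderiv_on_open[OF assms(1) x(1) u x(2)[OF u]] vderiv_on_open[OF assms(1) y(1) u y(2)[OF u]]
    by simp_all
  show "vderiv (\<lambda>t. Y t $ 1) u \<noteq> 0 \<or> vderiv (\<lambda>t. Y t $ 2) u \<noteq> 0"
    unfolding D by (rule ODE(1)[OF u])
  show "vderiv (\<lambda>t. Y t $ 1) u * vderiv (vderiv (\<lambda>t. Y t $ 2)) u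
        - vderiv (\<lambda>t. Y t $ 2) u * vderiv (vderiv (\<lambda>t. Y t $ 1)) u
      = - ((Y u $ 2) ^ 3 * vderiv (\<lambda>t. Y t $ 1) u ^ 3)"
    unfolding D by (rule ODE(2)[OF u])
qed (fact assms)+

text \<open>The quotient \<open>x'^2 / |Y'|^2\<close>, the squared cosine of the tangent angle, satisfies a linear homogeneous equation along the curve. Its
  derivative contains the factor \<open>x' y'' - y' x''\<close>, which the equation turns into a multiple of
  \<open>x'^3\<close>. Dividing by \<open>|Y'|^2\<close> keeps the coefficient continuous where \<open>y'\<close> vanishes.\<close>

lemma tangent_stays_vertical:
  fixes x1 x2 y y1 y2 :: "real \<Rightarrow> real"
  assumes I: "is_interval I"
    and x1: "\<And>u. u \<in> I \<Longrightarrow> (x1 has_real_derivative x2 u) (at u)"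
    and y: "\<And>u. u \<in> I \<Longrightarrow> (y has_real_derivative y1 u) (at u)"
    and y1: "\<And>u. u \<in> I \<Longrightarrow> (y1 has_real_derivative y2 u) (at u)"
    and nz: "\<And>u. u \<in> I \<Longrightarrow> x1 u \<noteq> 0 \<or> y1 u \<noteq> 0"
    and ODE: "\<And>u. u \<in> I \<Longrightarrow> x1 u * y2 u - y1 u * x2 u = - (y u ^ 3 * x1 u ^ 3)"
    and "a \<in> I" "x1 a = 0" "b \<in> I"
  shows "x1 b = 0"
proof -
  define s where "s u = x1 u * x1 u + y1 u * y1 u" for u
  define q where "q u = 2 * y1 u * y u ^ 3 * (x1 u * x1 u) / s u" for u
  define D where "D u = x1 u * x1 u / s u" for u
  have s: "s u > 0" if "u \<in> I" for u
    using nz[OF that] by (auto simp: s_def sum_squares_gt_zero_iff)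
  have sD: "(s has_real_derivative 2 * x1 u * x2 u + 2 * y1 u * y2 u) (at u)" if "u \<in> I" for u
    using DERIV_add[OF DERIV_mult[OF x1 x1] DERIV_mult[OF y1 y1], OF that that that that]
    by (simp add: s_def[abs_def] algebra_simps)
  have "D b = 0"
  proof (rule gronwall_zero[OF I, where D = D and b = b and D' = "\<lambda>u. q u * D u" and K = "\<lambda>u. \<bar>q u\<bar>" and a = a])
    fix u assume u: "u \<in> I"
    have "(D has_real_derivative
        ((x2 u * x1 u + x2 u * x1 u) * s u - x1 u * x1 u * (2 * x1 u * x2 u + 2 * y1 u * y2 u)) / (s u * s u)) (at u)"
      using DERIV_divide[OF DERIV_mult[OF x1 x1] sD, OF u u u] s[OF u] by (simp add: D_def[abs_def])
    also have "(x2 u * x1 u + x2 u * x1 u) * s u - x1 u * x1 u * (2 * x1 u * x2 u + 2 * y1 u * y2 u)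
        = - 2 * x1 u * y1 u * (x1 u * y2 u - y1 u * x2 u)"
      by (simp add: s_def algebra_simps)
    also have "- 2 * x1 u * y1 u * (x1 u * y2 u - y1 u * x2 u) / (s u * s u) = q u * D u"
      unfolding ODE[OF u] by (simp add: q_def D_def power3_eq_cube)
    finally show "(D has_real_derivative q u * D u) (at u)" .
    show nonneg: "0 \<le> D u" using s[OF u] by (simp add: D_def)
    show "\<bar>q u * D u\<bar> \<le> \<bar>q u\<bar> * D u" using nonneg by (simp add: abs_mult)
  next
    have "continuous_on I x1" "continuous_on I y" "continuous_on I y1" "continuous_on I s"
      using x1 y y1 sD by (meson DERIV_isCont continuous_at_imp_continuous_on)+
    moreover have "\<forall>u\<in>I. s u \<noteq> 0" using s by fastforce
    ultimately show "continuous_on I (\<lambda>u. \<bar>q u\<bar>)"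
      unfolding q_def by (intro continuous_intros)
  qed (use assms in \<open>simp_all add: D_def\<close>)
  then show ?thesis using s[OF \<open>b \<in> I\<close>] by (simp add: D_def)
qed

text \<open>Along a curve without vertical tangents, the height \<open>y\<close> and the slope \<open>y' / x'\<close> satisfy
  the oscillator equation \<open>w'' = -w^3\<close>, written with the parameter \<open>u\<close> in place of the abscissa.
  Comparing them with \<open>w\<close> and \<open>v\<close> pulled back along \<open>x\<close> gives uniqueness without having to
  invert \<open>x\<close>.\<close>

lemma graph_unique:
  fixes x x1 x2 y y1 y2 w v :: "real \<Rightarrow> real"
  assumes I: "is_interval I"
    and x: "\<And>u. u \<in> I \<Longrightarrow> (x has_real_derivative x1 u) (at u)"
    and x1: "\<And>u. u \<in> I \<Longrightarrow> (x1 has_real_derivative x2 u) (at u)"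
    and y: "\<And>u. u \<in> I \<Longrightarrow> (y has_real_derivative y1 u) (at u)"
    and y1: "\<And>u. u \<in> I \<Longrightarrow> (y1 has_real_derivative y2 u) (at u)"
    and nz: "\<And>u. u \<in> I \<Longrightarrow> x1 u \<noteq> 0"
    and ODE: "\<And>u. u \<in> I \<Longrightarrow> x1 u * y2 u - y1 u * x2 u = - (y u ^ 3 * x1 u ^ 3)"
    and w: "\<And>t. (w has_real_derivative v t) (at t)"
    and v: "\<And>t. (v has_real_derivative - (w t ^ 3)) (at t)"
    and a: "a \<in> I" "w (x a) = y a" "v (x a) = y1 a / x1 a"
    and b: "b \<in> I"
  shows "y b = w (x b)"
proof -
  define d where "d u = y u - w (x u)" for u
  define e where "e u = y1 u / x1 u - v (x u)" for u
  define D where "D u = d u * d u + e u * e u" for u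
  \<comment> \<open>the second factor is 1 minus the difference quotient of the cube between y and w\<close>
  define k where "k u = x1 u * (1 - (y u * y u + y u * w (x u) + w (x u) * w (x u)))" for u
  have "D b = 0"
  proof (rule gronwall_zero[OF I, where D = D and b = b and D' = "\<lambda>u. 2 * d u * e u * k u" and K = "\<lambda>u. \<bar>k u\<bar>" and a = a])
    fix u assume u: "u \<in> I"
    have "(d has_real_derivative y1 u - v (x u) * x1 u) (at u)"
      unfolding d_def[abs_def] by (intro DERIV_diff y u DERIV_chain2[OF w x])
    also have "y1 u - v (x u) * x1 u = e u * x1 u"
      using nz[OF u] by (simp add: e_def field_simps)
    finally have d: "(d has_real_derivative e u * x1 u) (at u)" .
    have "(e has_real_derivative
        (y2 u * x1 u - y1 u * x2 u) / (x1 u * x1 u) - - (w (x u) ^ 3) * x1 u) (at u)"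
      unfolding e_def[abs_def] by (intro DERIV_diff DERIV_divide y1 x1 u nz DERIV_chain2[OF v x])
    also have "(y2 u * x1 u - y1 u * x2 u) / (x1 u * x1 u) = - (y u ^ 3 * x1 u)"
      using ODE[OF u] nz[OF u] by (simp add: power3_eq_cube mult.commute[of "y2 u"])
    finally have e: "(e has_real_derivative - (y u ^ 3 * x1 u) - - (w (x u) ^ 3) * x1 u) (at u)" .
    show "(D has_real_derivative 2 * d u * e u * k u) (at u)"
      using DERIV_add[OF DERIV_mult[OF d d] DERIV_mult[OF e e]]
      by (simp add: D_def[abs_def] k_def d_def power3_eq_cube algebra_simps)
    have "\<bar>2 * d u * e u\<bar> \<le> D u"
      using sum_squares_bound[of "d u" "e u"] sum_squares_bound[of "d u" "- e u"]
      by (simp add: D_def power2_eq_square abs_le_iff)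
    then show "\<bar>2 * d u * e u * k u\<bar> \<le> \<bar>k u\<bar> * D u"
      using mult_right_mono[of "\<bar>2 * d u * e u\<bar>" "D u" "\<bar>k u\<bar>"] by (simp add: abs_mult mult_ac)
    show "0 \<le> D u" by (simp add: D_def)
  next
    have c: "continuous_on I x" "continuous_on I x1" "continuous_on I y"
      using x x1 y by (meson DERIV_isCont continuous_at_imp_continuous_on)+
    have "continuous_on UNIV w"
      using w by (meson DERIV_isCont continuous_at_imp_continuous_on)
    then have "continuous_on I (\<lambda>u. w (x u))"
      by (rule continuous_on_compose2[OF _ c(1)]) simp
    with c show "continuous_on I (\<lambda>u. \<bar>k u\<bar>)"
      unfolding k_def by (intro continuous_intros)
  qed (use a b in \<open>simp_all add: D_def d_def e_def\<close>)
  then show ?thesis by (simp add: D_def d_def sum_squares_eq_zero_iff)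
qed

text \<open>The algebra generated by \<open>w \<circ> \<phi>\<close>, \<open>v \<circ> \<phi>\<close> and all derivatives of \<open>\<phi>\<close> is closed under
  differentiation, by the chain rule and the equations for \<open>w\<close> and \<open>v\<close>.\<close>

lemma smooth_on_oscillator_compose:
  assumes "open I" and \<phi>: "smooth_on I (\<phi> :: real \<Rightarrow> real)"
    and w: "\<And>t. (w has_real_derivative v t) (at t)"
    and v: "\<And>t. (v has_real_derivative - (w t ^ 3)) (at t)"
  shows "smooth_on I (\<lambda>u. w (\<phi> u))"
proof -
  define S where "S = insert (\<lambda>u. w (\<phi> u)) (insert (\<lambda>u. v (\<phi> u)) (range (\<lambda>k. (vderiv ^^ k) \<phi>)))"
  have W: "(\<lambda>u. w (\<phi> u)) \<in> algebra_of S" and V: "(\<lambda>u. v (\<phi> u)) \<in> algebra_of S"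
    by (rule algebra_of.gen, simp add: S_def)+
  have P: "(vderiv ^^ k) \<phi> \<in> algebra_of S" for k
    by (rule algebra_of.gen) (simp add: S_def)
  have iter: "smooth_on I ((vderiv ^^ k) \<phi>)" for k
  proof (induction k)
    case 0
    show ?case using \<phi> by simp
  next
    case (Suc k)
    show ?case using smooth_on_vderiv[OF Suc] by simp
  qed
  have D: "(\<phi> has_real_derivative (vderiv ^^ 1) \<phi> u) (at u)" if "u \<in> I" for u
    using smooth_on_DERIV[OF \<phi> that] by simp
  show ?thesis
  proof (rule smooth_on_algebra_of[OF \<open>open I\<close> W])
    fix f assume "f \<in> S"
    then consider "f = (\<lambda>u. w (\<phi> u))" | "f = (\<lambda>u. v (\<phi> u))" | k where "f = (vderiv ^^ k) \<phi>"
      unfolding S_def by blast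
    then show "\<exists>g\<in>algebra_of S. \<forall>u\<in>I. (f has_real_derivative g u) (at u)"
    proof cases
      case 1
      have "\<forall>u\<in>I. (f has_real_derivative v (\<phi> u) * (vderiv ^^ 1) \<phi> u) (at u)"
        unfolding 1 using DERIV_chain2[OF w D] by blast
      then show ?thesis by (rule bexI[OF _ algebra_of.mult[OF V P]])
    next
      case 2
      have "\<forall>u\<in>I. (f has_real_derivative
          -1 * (w (\<phi> u) * (w (\<phi> u) * w (\<phi> u))) * (vderiv ^^ 1) \<phi> u) (at u)"
      proof
        fix u assume "u \<in> I"
        from DERIV_chain2[OF v D[OF this]]
        show "(f has_real_derivative -1 * (w (\<phi> u) * (w (\<phi> u) * w (\<phi> u))) * (vderiv ^^ 1) \<phi> u) (at u)"
          unfolding 2 by (simp add: power3_eq_cube mult.assoc)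
      qed
      then show ?thesis
        by (rule bexI[OF _ algebra_of.mult[OF algebra_of.mult[OF algebra_of.const
          algebra_of.mult[OF W algebra_of.mult[OF W W]]] P]])
    next
      case (3 k)
      have "\<forall>u\<in>I. (f has_real_derivative (vderiv ^^ Suc k) \<phi> u) (at u)"
        unfolding 3 using smooth_on_DERIV[OF iter] by simp
      then show ?thesis by (rule bexI[OF _ P])
    qed
  qed
qed

text \<open>For a graph, \<open>x' y'' - y' x''\<close> is \<open>x'^3\<close> times the second derivative of the graph function,
  so the curve equation reduces to \<open>w'' = -w^3\<close>. The value of the horizontal component of the
  velocity is recorded because it decides between the two types of solutions.\<close>

lemma graph_solution:
  assumes I: "open I" "connected I" "I \<noteq> {}"
    and \<phi>: "smooth_on I \<phi>" "\<And>u. u \<in> I \<Longrightarrow> vderiv \<phi> u \<noteq> (0::real)"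
    and w: "\<And>t. (w has_real_derivative v t) (at t)"
    and v: "\<And>t. (v has_real_derivative - (w t ^ 3)) (at t)"
    and Y: "\<And>u. u \<in> I \<Longrightarrow> Y u = vector [\<phi> u, w (\<phi> u)]"
  shows "solution_curve height_matrix I Y"
    "\<And>u. u \<in> I \<Longrightarrow> vderiv (\<lambda>t. Y t $ 1) u = vderiv \<phi> u"
proof -
  have Y1: "Y u $ 1 = \<phi> u" and Y2: "Y u $ 2 = w (\<phi> u)" if "u \<in> I" for u
    using Y[OF that] by simp_all
  have D: "(\<phi> has_real_derivative vderiv \<phi> u) (at u)" if "u \<in> I" for u
    by (rule smooth_on_DERIV[OF \<phi>(1) that])
  have D2: "(vderiv \<phi> has_real_derivative vderiv (vderiv \<phi>) u) (at u)" if "u \<in> I" for u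
    by (rule smooth_on_DERIV[OF smooth_on_vderiv[OF \<phi>(1)] that])
  have x: "((\<lambda>t. Y t $ 1) has_real_derivative vderiv \<phi> u) (at u)" if "u \<in> I" for u
    by (rule has_field_derivative_transform_within_open[OF D[OF that] I(1) that])
      (simp add: Y1)
  have y: "((\<lambda>t. Y t $ 2) has_real_derivative v (\<phi> u) * vderiv \<phi> u) (at u)" if "u \<in> I" for u
    by (rule has_field_derivative_transform_within_open[OF DERIV_chain2[OF w D[OF that]] I(1) that])
      (simp add: Y2)
  show "vderiv (\<lambda>t. Y t $ 1) u = vderiv \<phi> u" if "u \<in> I" for u
    using x[OF that] by (simp add: has_real_derivative_iff_has_vector_derivative vector_derivative_at)
  show "solution_curve height_matrix I Y"
  proof (rule solution_curveI[OF I _ _ x D2 y])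
    show "smooth_on I (\<lambda>t. Y t $ 1)"
      by (rule smooth_on_cong[OF I(1) \<phi>(1) Y1])
    show "smooth_on I (\<lambda>t. Y t $ 2)"
      by (rule smooth_on_cong[OF I(1) smooth_on_oscillator_compose[OF I(1) \<phi>(1) w v] Y2])
    fix u assume u: "u \<in> I"
    show "((\<lambda>u. v (\<phi> u) * vderiv \<phi> u) has_real_derivative
        - (w (\<phi> u) ^ 3) * vderiv \<phi> u * vderiv \<phi> u + vderiv (vderiv \<phi>) u * v (\<phi> u)) (at u)"
      by (rule DERIV_mult[OF DERIV_chain2[OF v D[OF u]] D2[OF u]])
    show "vderiv \<phi> u \<noteq> 0 \<or> v (\<phi> u) * vderiv \<phi> u \<noteq> 0"
      using \<phi>(2)[OF u] by blast
    show "vderiv \<phi> u * (- (w (\<phi> u) ^ 3) * vderiv \<phi> u * vderiv \<phi> u + vderiv (vderiv \<phi>) u * v (\<phi> u))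
        - v (\<phi> u) * vderiv \<phi> u * vderiv (vderiv \<phi>) u = - ((Y u $ 2) ^ 3 * vderiv \<phi> u ^ 3)"
      unfolding Y2[OF u] by (simp add: power3_eq_cube algebra_simps)
  qed
qed

lemma vertical_solution:
  assumes I: "open I" "connected I" "I \<noteq> {}"
    and \<phi>: "smooth_on I \<phi>" "\<And>u. u \<in> I \<Longrightarrow> vderiv \<phi> u \<noteq> (0::real)"
    and Y: "\<And>u. u \<in> I \<Longrightarrow> Y u = vector [C, \<phi> u]"
  shows "solution_curve height_matrix I Y"
    "\<And>u. u \<in> I \<Longrightarrow> vderiv (\<lambda>t. Y t $ 1) u = 0"
proof -
  have Y1: "Y u $ 1 = C" and Y2: "Y u $ 2 = \<phi> u" if "u \<in> I" for u
    using Y[OF that] by simp_all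
  have x: "((\<lambda>t. Y t $ 1) has_real_derivative 0) (at u)" if "u \<in> I" for u
    by (rule has_field_derivative_transform_within_open[OF DERIV_const I(1) that]) (simp add: Y1)
  have y: "((\<lambda>t. Y t $ 2) has_real_derivative vderiv \<phi> u) (at u)" if "u \<in> I" for u
    by (rule has_field_derivative_transform_within_open[OF smooth_on_DERIV[OF \<phi>(1) that] I(1) that])
      (simp add: Y2)
  show "vderiv (\<lambda>t. Y t $ 1) u = 0" if "u \<in> I" for u
    using x[OF that] by (simp add: has_real_derivative_iff_has_vector_derivative vector_derivative_at)
  show "solution_curve height_matrix I Y"
  proof (rule solution_curveI[OF I _ _ x DERIV_const y smooth_on_DERIV[OF smooth_on_vderiv[OF \<phi>(1)]]])
    show "smooth_on I (\<lambda>t. Y t $ 1)"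
      by (rule smooth_on_cong[OF I(1) smooth_on_const[OF I(1)] Y1])
    show "smooth_on I (\<lambda>t. Y t $ 2)"
      by (rule smooth_on_cong[OF I(1) \<phi>(1) Y2])
  qed (use \<phi>(2) in simp_all)
qed

section \<open>The oscillation of the cubic spring\<close>

text \<open>Substituting \<open>\<xi> = a * sin \<theta>\<close> with \<open>a ^ 4 = 2 * C\<close> turns \<open>1 / sqrt (C - \<xi> ^ 4 / 2) d\<xi>\<close> into
  \<open>sqrt 2 / (a * sqrt (1 + sin\<^sup>2 \<theta>)) d\<theta>\<close>. The singularities at the turning points disappear, and the
  integral is an increasing bijection of the whole line (an elliptic integral of the first kind).
  Its inverse is the phase angle as a function of the abscissa, the analogue of the Jacobi
  amplitude; the oscillation so obtained needs no gluing of arcs.\<close>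

definition angle_time :: "real \<Rightarrow> real \<Rightarrow> real" where
  "angle_time a t = (LBINT s=0..ereal t. sqrt 2 / (a * sqrt (1 + (sin s)\<^sup>2)))"

definition time_angle :: "real \<Rightarrow> real \<Rightarrow> real" where
  "time_angle a = inv (angle_time a)"

definition oscillation :: "real \<Rightarrow> real \<Rightarrow> real" where
  "oscillation a x = a * sin (time_angle a x)"

definition velocity :: "real \<Rightarrow> real \<Rightarrow> real" where
  "velocity a x = a\<^sup>2 / sqrt 2 * cos (time_angle a x) * sqrt (1 + (sin (time_angle a x))\<^sup>2)"

lemma one_plus_sin2_pos: "0 < 1 + (sin t)\<^sup>2" for t :: real
  by (simp add: add_pos_nonneg)

lemma angle_time_0: "angle_time a 0 = 0"
  by (simp add: angle_time_def zero_ereal_def[symmetric])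

lemma angle_time_DERIV:
  assumes "a > 0"
  shows "(angle_time a has_real_derivative sqrt 2 / (a * sqrt (1 + (sin t)\<^sup>2))) (at t)"
proof -
  let ?R = "\<bar>t\<bar> + 1"
  have "a * sqrt (1 + (sin s)\<^sup>2) \<noteq> 0" for s
    using assms one_plus_sin2_pos[of s] by simp
  then have "continuous_on {-?R..?R} (\<lambda>s. sqrt 2 / (a * sqrt (1 + (sin s)\<^sup>2)))"
    by (intro continuous_intros ballI)
  then have "((\<lambda>u. LBINT s=ereal 0..ereal u. sqrt 2 / (a * sqrt (1 + (sin s)\<^sup>2)))
      has_vector_derivative sqrt 2 / (a * sqrt (1 + (sin t)\<^sup>2))) (at t within {-?R..?R})"
    by (intro interval_integral_FTC2) auto
  moreover have "at t within {-?R..?R} = at t"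
    by (intro at_within_Icc_at) auto
  ultimately show ?thesis
    by (simp add: has_real_derivative_iff_has_vector_derivative angle_time_def[abs_def] zero_ereal_def)
qed

text \<open>The integrand is even, and by the following lemma also periodic with period \<open>pi\<close>: these are
  the symmetries that make the three arcs of the profile fit together.\<close>

lemma angle_time_minus:
  assumes "a > 0"
  shows "angle_time a (- t) = - angle_time a t"
proof -
  note D = angle_time_DERIV[OF assms]
  have "((\<lambda>t. angle_time a (- t) + angle_time a t) has_real_derivative 0) (at t)" for t
    using DERIV_add[OF DERIV_chain2[OF D[of "- t"] DERIV_minus[OF DERIV_ident]] D[of t]] by simp
  from DERIV_isconst_all[OF allI[OF this], of t 0] show ?thesis
    by (simp add: angle_time_0)
qed

lemma angle_time_add_pi:
  assumes "a > 0"
  shows "angle_time a (t + pi) = angle_time a t + angle_time a pi"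
proof -
  note D = angle_time_DERIV[OF assms]
  have "((\<lambda>t. angle_time a (t + pi) - angle_time a t) has_real_derivative 0) (at t)" for t
    using DERIV_diff[OF DERIV_chain2[OF D[of "t + pi"] DERIV_add[OF DERIV_ident DERIV_const]] D[of t]]
    by simp
  from DERIV_isconst_all[OF allI[OF this], of t 0] show ?thesis
    by (simp add: angle_time_0)
qed

lemma angle_time_pi_minus:
  assumes "a > 0"
  shows "angle_time a (pi - t) = angle_time a pi - angle_time a t"
  using angle_time_add_pi[OF assms, of "- t"] angle_time_minus[OF assms, of t] by simp

lemma angle_time_pi:
  assumes "a > 0"
  shows "angle_time a pi = 2 * angle_time a (pi/2)"
  using angle_time_pi_minus[OF assms, of "pi/2"] by simp

lemma strict_mono_angle_time:
  assumes "a > 0"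
  shows "strict_mono (angle_time a)"
proof (rule strict_monoI)
  fix s t :: real assume "s < t"
  then show "angle_time a s < angle_time a t"
  proof (rule DERIV_pos_imp_increasing)
    fix x
    have "0 < sqrt 2 / (a * sqrt (1 + (sin x)\<^sup>2))"
      using assms one_plus_sin2_pos[of x] by simp
    then show "\<exists>y. (angle_time a has_real_derivative y) (at x) \<and> 0 < y"
      using angle_time_DERIV[OF assms] by blast
  qed
qed

text \<open>The integrand is at least \<open>1 / a\<close>, so the integral grows at least linearly.\<close>

lemma surj_angle_time:
  assumes "a > 0"
  shows "surj (angle_time a)"
proof -
  have large: "t / a \<le> angle_time a t" if "0 \<le> t" for t
  proof -
    have "angle_time a 0 - 0 / a \<le> angle_time a t - t / a"
    proof (rule DERIV_nonneg_imp_nondecreasing[OF that])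
      fix x :: real
      have "(sin x)\<^sup>2 \<le> 1" by (simp only: abs_square_le_1 abs_sin_le_one)
      then have "sqrt (1 + (sin x)\<^sup>2) \<le> sqrt 2" by simp
      then have "0 \<le> sqrt 2 / (a * sqrt (1 + (sin x)\<^sup>2)) - 1 / a"
        using assms one_plus_sin2_pos[of x] by (simp add: field_simps)
      moreover have "((\<lambda>t. angle_time a t - t / a) has_real_derivative
          sqrt 2 / (a * sqrt (1 + (sin x)\<^sup>2)) - 1 / a) (at x)"
        by (intro DERIV_diff angle_time_DERIV assms DERIV_cdivide DERIV_ident)
      ultimately show "\<exists>y. ((\<lambda>t. angle_time a t - t / a) has_real_derivative y) (at x) \<and> 0 \<le> y"
        by blast
    qed
    then show ?thesis by (simp add: angle_time_0)
  qed
  have "\<exists>t. angle_time a t = x" for x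
  proof -
    have "\<bar>x\<bar> \<le> angle_time a (a * \<bar>x\<bar>)"
      using large[of "a * \<bar>x\<bar>"] assms by simp
    then have "angle_time a (- (a * \<bar>x\<bar>)) \<le> x" "x \<le> angle_time a (a * \<bar>x\<bar>)"
      unfolding angle_time_minus[OF assms] by linarith+
    moreover have "isCont (angle_time a) t" for t
      using DERIV_isCont angle_time_DERIV[OF assms] by blast
    ultimately show ?thesis
      using IVT[of "angle_time a" "- (a * \<bar>x\<bar>)" x "a * \<bar>x\<bar>"] assms by auto
  qed
  then show ?thesis by (metis surjI)
qed

lemma angle_time_time_angle: "a > 0 \<Longrightarrow> angle_time a (time_angle a x) = x"
  by (simp add: time_angle_def surj_angle_time surj_f_inv_f)

lemma time_angle_eq: "a > 0 \<Longrightarrow> angle_time a t = x \<Longrightarrow> time_angle a x = t"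
  using strict_mono_imp_inj_on[OF strict_mono_angle_time[of a], of UNIV]
  by (auto simp: time_angle_def)

lemma time_angle_DERIV:
  assumes "a > 0"
  shows "(time_angle a has_real_derivative a * sqrt (1 + (sin (time_angle a x))\<^sup>2) / sqrt 2) (at x)"
proof -
  let ?t = "time_angle a x"
  have "isCont (time_angle a) (angle_time a ?t)"
  proof (rule isCont_inverse_function[where f = "angle_time a" and x = ?t and d = 1])
    show "isCont (angle_time a) z" for z
      using DERIV_isCont angle_time_DERIV[OF assms] by blast
  qed (simp_all add: time_angle_eq[OF assms refl])
  then have "isCont (time_angle a) x"
    by (simp only: angle_time_time_angle[OF assms])
  moreover have "sqrt 2 / (a * sqrt (1 + (sin ?t)\<^sup>2)) \<noteq> 0"
    using assms one_plus_sin2_pos[of ?t] by simp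
  ultimately have "(time_angle a has_real_derivative inverse (sqrt 2 / (a * sqrt (1 + (sin ?t)\<^sup>2)))) (at x)"
    by (intro DERIV_inverse_function[OF angle_time_DERIV[OF assms], where x = x and a = "x - 1" and b = "x + 1"])
      (simp_all add: angle_time_time_angle[OF assms])
  then show ?thesis by simp
qed

lemma oscillation_DERIV:
  assumes "a > 0"
  shows "(oscillation a has_real_derivative velocity a x) (at x)"
proof -
  have "((\<lambda>x. a * sin (time_angle a x)) has_real_derivative
      a * (cos (time_angle a x) * (a * sqrt (1 + (sin (time_angle a x))\<^sup>2) / sqrt 2))) (at x)"
    by (intro DERIV_cmult DERIV_chain2[OF DERIV_sin time_angle_DERIV] assms)
  then show ?thesis
    by (simp add: oscillation_def[abs_def] velocity_def power2_eq_square mult.assoc mult.left_commute)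
qed

text \<open>The angle derivative of \<open>cos t * sqrt (1 + sin\<^sup>2 t)\<close> is
  \<open>-2 * sin\<^sup>3 t / sqrt (1 + sin\<^sup>2 t)\<close>, and the speed of the angle cancels the remaining root.\<close>

lemma velocity_DERIV:
  assumes "a > 0"
  shows "(velocity a has_real_derivative - (oscillation a x ^ 3)) (at x)"
proof -
  let ?s = "sin (time_angle a x)" and ?c = "cos (time_angle a x)"
  define r where "r = sqrt (1 + ?s\<^sup>2)"
  have r: "r > 0" "r * r = 1 + ?s\<^sup>2"
    using one_plus_sin2_pos[of "time_angle a x"] by (simp_all add: r_def)
  have c: "?c * ?c = 1 - ?s * ?s"
    using sin_cos_squared_add[of "time_angle a x"] by (simp add: power2_eq_square)
  have "((\<lambda>t. cos t * sqrt (1 + (sin t)\<^sup>2)) has_real_derivative - (2 * ?s ^ 3) / r) (at (time_angle a x))"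
  proof -
    have "((\<lambda>t. cos t * sqrt (1 + (sin t)\<^sup>2)) has_real_derivative
        - ?s * r + ?c * (2 * ?s * ?c * (1 / (2 * r)))) (at (time_angle a x))"
      using one_plus_sin2_pos[of "time_angle a x"]
      by (auto intro!: derivative_eq_intros simp: r_def field_simps)
    also have "- ?s * r + ?c * (2 * ?s * ?c * (1 / (2 * r))) = (- ?s * (r * r) + ?s * (?c * ?c)) / r"
      using r(1) by (simp add: field_simps)
    also have "\<dots> = - (2 * ?s ^ 3) / r"
      unfolding r(2) c by (simp add: power2_eq_square power3_eq_cube algebra_simps)
    finally show ?thesis .
  qed
  from DERIV_cmult[OF DERIV_chain2[OF this time_angle_DERIV[OF assms]], of "a\<^sup>2 / sqrt 2"]
  have "((\<lambda>x. a\<^sup>2 / sqrt 2 * (cos (time_angle a x) * sqrt (1 + (sin (time_angle a x))\<^sup>2)))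
      has_real_derivative a\<^sup>2 / sqrt 2 * (- (2 * ?s ^ 3) / r * (a * r / sqrt 2))) (at x)"
    by (simp only: r_def)
  also have "a\<^sup>2 / sqrt 2 * (- (2 * ?s ^ 3) / r * (a * r / sqrt 2)) = - (oscillation a x ^ 3)"
    using r(1) by (simp add: oscillation_def field_simps power2_eq_square power3_eq_cube)
  finally show ?thesis
    by (simp add: velocity_def[abs_def] mult.assoc)
qed

text \<open>On the energy level \<open>p^2 + y^4 / 2 = a^4 / 2\<close> the height fixes the sine of the angle and
  the energy then fixes the slope up to sign; the choice between \<open>arcsin\<close> and its reflection at
  \<open>pi / 2\<close> adjusts the sign. So every nonzero initial value is attained by a translate of an
  oscillation.\<close>

lemma oscillation_phase:
  assumes "a > 0" and energy: "a ^ 4 = 2 * p\<^sup>2 + y ^ 4"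
  shows "\<exists>x. oscillation a x = y \<and> velocity a x = p"
proof -
  define s where "s = y / a"
  have y: "y = a * s" using assms(1) by (simp add: s_def)
  have p2: "2 * p\<^sup>2 = a ^ 4 * (1 - s ^ 4)"
    using energy by (simp add: y power_mult_distrib algebra_simps)
  have "0 \<le> a ^ 4 * (1 - s ^ 4)" using p2 by (metis mult_nonneg_nonneg zero_le_numeral zero_le_power2)
  then have "s ^ 4 \<le> 1" using assms(1) by (simp add: zero_le_mult_iff)
  then have s: "-1 \<le> s" "s \<le> 1"
    using power_le_one_iff[of "\<bar>s\<bar>" 4] by (simp_all add: power_even_abs)
  define t where "t = (if 0 \<le> p then arcsin s else pi - arcsin s)"
  have sin_t: "sin t = s" using s by (simp add: t_def)
  have cos_t: "(0 \<le> p \<longrightarrow> 0 \<le> cos t) \<and> (p < 0 \<longrightarrow> cos t \<le> 0)"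
    using s by (simp add: t_def cos_arcsin abs_square_le_1 abs_le_iff)
  have tt: "time_angle a (angle_time a t) = t" by (rule time_angle_eq[OF assms(1) refl])
  define v where "v = velocity a (angle_time a t)"
  have v: "v = a\<^sup>2 / sqrt 2 * cos t * sqrt (1 + s\<^sup>2)"
    by (simp add: v_def velocity_def tt sin_t)
  have c2: "(cos t)\<^sup>2 = 1 - s\<^sup>2" using sin_t by (simp add: cos_squared_eq)
  have "v\<^sup>2 = a ^ 4 / 2 * (1 - s\<^sup>2) * (1 + s\<^sup>2)"
    by (simp add: v power_mult_distrib power_divide c2 flip: power_mult)
  also have "\<dots> = p\<^sup>2"
    using p2 by (simp add: algebra_simps flip: power_add)
  finally have "\<bar>v\<bar> = \<bar>p\<bar>" by (simp add: power2_eq_iff abs_eq_iff)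
  moreover have "0 \<le> p \<longrightarrow> 0 \<le> v" "p < 0 \<longrightarrow> v \<le> 0"
  proof -
    define k where "k = a\<^sup>2 / sqrt 2 * sqrt (1 + s\<^sup>2)"
    have "v = k * cos t" "0 \<le> k" by (simp_all add: v k_def)
    then show "0 \<le> p \<longrightarrow> 0 \<le> v" "p < 0 \<longrightarrow> v \<le> 0"
      using cos_t by (auto intro: mult_nonneg_nonneg mult_nonneg_nonpos)
  qed
  ultimately have "v = p" by linarith
  then show ?thesis
    using tt by (intro exI[of _ "angle_time a t"]) (simp add: v_def oscillation_def sin_t y)
qed

section \<open>The periodic profile\<close>

lemma amplitude_pos: "C > 0 \<Longrightarrow> amplitude C > 0"
  by (simp add: amplitude_def)

lemma amplitude_pow4: "C > 0 \<Longrightarrow> amplitude C ^ 4 = 2 * C"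
  by (simp add: amplitude_def)

lemma arcsin_antiderivative:
  assumes "C > 0" "\<bar>\<xi>\<bar> < amplitude C"
  shows "((\<lambda>\<xi>. angle_time (amplitude C) (arcsin (\<xi> / amplitude C))) has_real_derivative
      1 / sqrt (C - 1/2 * \<xi> ^ 4)) (at \<xi>)"
proof -
  define a where "a = amplitude C"
  have a: "a > 0" "a ^ 4 = 2 * C" using assms(1) amplitude_pos amplitude_pow4 by (auto simp: a_def)
  define s where "s = \<xi> / a"
  have \<xi>: "\<xi> = a * s" using a by (simp add: s_def)
  have "\<bar>s\<bar> < 1" using assms(2) a(1) by (simp add: s_def flip: a_def)
  then have s: "-1 < s" "s < 1" "s\<^sup>2 < 1" by (auto simp: abs_square_less_1)
  have "((\<lambda>\<xi>. angle_time a (arcsin (\<xi> / a))) has_real_derivative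
      sqrt 2 / (a * sqrt (1 + (sin (arcsin (\<xi> / a)))\<^sup>2)) * (inverse (sqrt (1 - (\<xi> / a)\<^sup>2)) * (1 / a))) (at \<xi>)"
    using s by (intro DERIV_chain2[OF angle_time_DERIV[OF a(1)]]
        DERIV_chain2[OF DERIV_arcsin] DERIV_cdivide DERIV_ident) (simp_all add: s_def)
  also have "sqrt 2 / (a * sqrt (1 + (sin (arcsin (\<xi> / a)))\<^sup>2)) * (inverse (sqrt (1 - (\<xi> / a)\<^sup>2)) * (1 / a))
      = sqrt 2 / (a\<^sup>2 * (sqrt (1 + s\<^sup>2) * sqrt (1 - s\<^sup>2)))"
    using s by (simp add: s_def[symmetric] power2_eq_square field_simps)
  also have "\<dots> = 1 / (a\<^sup>2 / sqrt 2 * sqrt (1 - s ^ 4))"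
    by (simp add: algebra_simps flip: real_sqrt_mult power_add)
  also have "a\<^sup>2 / sqrt 2 * sqrt (1 - s ^ 4) = sqrt (a ^ 4 / 2 * (1 - s ^ 4))"
  proof -
    have "sqrt (a ^ 4) = a\<^sup>2" using real_sqrt_abs[of "a\<^sup>2"] by (simp flip: power_mult)
    then show ?thesis by (simp add: real_sqrt_mult real_sqrt_divide)
  qed
  also have "a ^ 4 / 2 * (1 - s ^ 4) = C - 1/2 * \<xi> ^ 4"
    by (simp add: \<xi> power_mult_distrib a(2) algebra_simps)
  finally show ?thesis by (simp add: a_def)
qed

text \<open>The antiderivative is continuous up to the turning points, so the improper integral of the
  nonnegative integrand is the difference of its boundary values even when \<open>p\<close> or \<open>q\<close> is one.\<close>

lemma arc_integral_between:
  assumes "C > 0" "- amplitude C \<le> p" "p < q" "q \<le> amplitude C"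
  shows "(LBINT \<xi>=ereal p..ereal q. 1 / sqrt (C - 1/2 * \<xi> ^ 4)) =
    angle_time (amplitude C) (arcsin (q / amplitude C)) - angle_time (amplitude C) (arcsin (p / amplitude C))"
proof -
  define a where "a = amplitude C"
  let ?H = "\<lambda>\<xi>. angle_time a (arcsin (\<xi> / a))"
  have a: "a > 0" "a ^ 4 = 2 * C" using assms(1) amplitude_pos amplitude_pow4 by (auto simp: a_def)
  have pos: "C - 1/2 * \<xi> ^ 4 > 0" if "p < \<xi>" "\<xi> < q" for \<xi>
  proof -
    have "\<bar>\<xi>\<bar> < a" using that assms by (auto simp: a_def)
    then have "\<bar>\<xi>\<bar> ^ 4 < a ^ 4" by (intro power_strict_mono) auto
    then show ?thesis by (simp add: a(2) power_even_abs)
  qed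
  have bounds: "-1 \<le> \<xi> / a \<and> \<xi> / a \<le> 1" if "\<xi> \<in> {p..q}" for \<xi>
    using that assms a(1) by (simp add: field_simps flip: a_def)
  have "continuous_on UNIV (angle_time a)"
    using angle_time_DERIV[OF a(1)] DERIV_isCont continuous_at_imp_continuous_on by blast
  then have cont: "continuous_on {p..q} ?H"
    by (rule continuous_on_compose2)
      (use bounds a(1) in \<open>auto intro!: continuous_on_arcsin' continuous_intros\<close>)
  have "(LBINT \<xi>=ereal p..ereal q. 1 / sqrt (C - 1/2 * \<xi> ^ 4)) = ?H q - ?H p"
  proof (rule interval_integral_FTC_nonneg(2))
    show "(?H has_real_derivative 1 / sqrt (C - 1/2 * \<xi> ^ 4)) (at \<xi>)"
      if "ereal p < ereal \<xi>" "ereal \<xi> < ereal q" for \<xi>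
      using arcsin_antiderivative[OF assms(1), of \<xi>] that assms by (auto simp: a_def)
    show "isCont (\<lambda>\<xi>. 1 / sqrt (C - 1/2 * \<xi> ^ 4)) \<xi>"
      if "ereal p < ereal \<xi>" "ereal \<xi> < ereal q" for \<xi>
      using pos[of \<xi>] that by (intro continuous_intros) auto
    show "AE \<xi> in lborel. ereal p < ereal \<xi> \<longrightarrow> ereal \<xi> < ereal q \<longrightarrow> 0 \<le> 1 / sqrt (C - 1/2 * \<xi> ^ 4)"
    proof (rule AE_I2, intro impI)
      fix \<xi> assume "ereal p < ereal \<xi>" "ereal \<xi> < ereal q"
      then show "0 \<le> 1 / sqrt (C - 1/2 * \<xi> ^ 4)" using pos[of \<xi>] by simp
    qed
    show "((?H \<circ> real_of_ereal) \<longlongrightarrow> ?H p) (at_right (ereal p))"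
      using cont \<open>p < q\<close> unfolding ereal_tendsto_simps
      by (auto simp: continuous_on_def simp flip: at_within_Icc_at_right[OF \<open>p < q\<close>])
    show "((?H \<circ> real_of_ereal) \<longlongrightarrow> ?H q) (at_left (ereal q))"
      using cont \<open>p < q\<close> unfolding ereal_tendsto_simps
      by (auto simp: continuous_on_def simp flip: at_within_Icc_at_left[OF \<open>p < q\<close>])
  qed (use \<open>p < q\<close> in simp)
  then show ?thesis by (simp add: a_def)
qed

lemma arc_integral_eq:
  assumes "C > 0" "\<bar>\<eta>\<bar> \<le> amplitude C"
  shows "arc_integral C \<eta> = angle_time (amplitude C) (arcsin (\<eta> / amplitude C))"
proof -
  consider "\<eta> = 0" | "\<eta> > 0" | "\<eta> < 0" by linarith
  then show ?thesis
  proof cases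
    case 1
    then show ?thesis by (simp add: arc_integral_def angle_time_0 zero_ereal_def[symmetric])
  next
    case 2
    then show ?thesis
      using arc_integral_between[OF assms(1), of 0 \<eta>] assms
      by (simp add: arc_integral_def angle_time_0 zero_ereal_def)
  next
    case 3
    then show ?thesis
      using arc_integral_between[OF assms(1), of \<eta> 0] assms
      by (simp add: arc_integral_def angle_time_0 zero_ereal_def
          interval_integral_endpoints_reverse[of "ereal 0"])
  qed
qed

lemma arc_integral_sin:
  assumes "C > 0" "\<bar>t\<bar> \<le> pi/2"
  shows "arc_integral C (amplitude C * sin t) = angle_time (amplitude C) t"
proof -
  have "\<bar>amplitude C * sin t\<bar> \<le> amplitude C"
    using amplitude_pos[OF assms(1)] by (simp add: abs_mult mult_le_cancel_left1)
  then show ?thesis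
    using arc_integral_eq[OF assms(1)] amplitude_pos[OF assms(1)] assms(2)
    by (simp add: arcsin_sin abs_le_iff)
qed

lemma period_eq:
  assumes "C > 0"
  shows "period C = 2 * angle_time (amplitude C) pi"
  using arc_integral_sin[OF assms, of "pi/2"] angle_time_pi[OF amplitude_pos[OF assms]]
  by (simp add: period_def)

text \<open>In terms of the angle, one closed period is \<open>-pi \<le> t \<le> pi\<close>. The first arc is
  \<open>\<bar>t\<bar> \<le> pi / 2\<close>, where \<open>sin\<close> is inverted by \<open>arcsin\<close>; on the other two arcs \<open>t\<close> is reflected to
  \<open>pi - t\<close> and \<open>- pi - t\<close>, which leaves \<open>sin t\<close> unchanged and replaces the integral by its difference
  to plus or minus half a period.\<close>

lemma periodic_profile_oscillation:
  assumes "C1 > 0"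
  shows "periodic_profile C1 C2 (\<lambda>x. oscillation (amplitude C1) (x - C2))"
proof -
  define a where "a = amplitude C1"
  define G where "G = angle_time a"
  define F where "F = arc_integral C1"
  let ?y = "\<lambda>x. oscillation a (x - C2)"
  have a: "a > 0" using amplitude_pos[OF assms] by (simp add: a_def)
  have T: "period C1 / 2 = G pi" using period_eq[OF assms] by (simp add: G_def a_def)
  have mono: "G s \<le> G t \<longleftrightarrow> s \<le> t" for s t
    using strict_mono_less_eq[OF strict_mono_angle_time[OF a]] by (simp add: G_def)
  have pi_minus: "G (pi - t) = G pi - G t" and minus: "G (- t) = - G t" and add_pi: "G (t + pi) = G t + G pi" for t
    using angle_time_pi_minus[OF a] angle_time_minus[OF a] angle_time_add_pi[OF a] by (simp_all add: G_def)
  have y: "?y (C2 + G t) = a * sin t" for t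
    by (simp add: oscillation_def G_def time_angle_eq[OF a refl])
  have F: "F (a * sin t) = G t" if "\<bar>t\<bar> \<le> pi/2" for t
    using arc_integral_sin[OF assms that] by (simp add: F_def G_def a_def)
  have param: "\<exists>t. x = C2 + G t" for x
    using angle_time_time_angle[OF a, of "x - C2"] by (intro exI[of _ "time_angle a (x - C2)"]) (simp add: G_def)
  have range: "a * sin t \<in> {-a..a}" for t
    using a mult_left_mono[of "sin t" 1 a] mult_left_mono[of "-1" "sin t" a] by simp
  have amp: "\<exists>t. \<eta> = a * sin t \<and> \<bar>t\<bar> \<le> pi/2 \<and> (0 \<le> \<eta> \<longrightarrow> 0 \<le> t) \<and> (\<eta> \<le> 0 \<longrightarrow> t \<le> 0)" if "\<eta> \<in> {-a..a}" for \<eta>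
  proof -
    have q: "-1 \<le> \<eta> / a" "\<eta> / a \<le> 1" using that a by (auto simp: field_simps)
    have "0 \<le> arcsin (\<eta> / a)" if "0 \<le> \<eta>"
      using arcsin_le_arcsin[of 0 "\<eta> / a"] q a that by simp
    moreover have "arcsin (\<eta> / a) \<le> 0" if "\<eta> \<le> 0"
      using arcsin_le_arcsin[of "\<eta> / a" 0] q a that by (simp add: divide_nonpos_pos)
    ultimately show ?thesis
      using a q arcsin_bounded[OF q] by (intro exI[of _ "arcsin (\<eta> / a)"]) (auto simp: abs_le_iff)
  qed
  have per: "?y (x + period C1) = ?y x" for x
  proof -
    obtain t where t: "x = C2 + G t" using param by blast
    have "x + period C1 = C2 + G (t + pi + pi)"
      unfolding add_pi t using T by simp
    moreover have "sin (t + pi + pi) = sin t" by (simp only: sin_periodic_pi minus_minus)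
    ultimately show ?thesis using y[of "t + pi + pi"] y[of t] by (simp only: t)
  qed
  have "{(x, ?y x) |x. x - C2 \<in> {- period C1 / 2..period C1 / 2}} =
         {(x, \<eta>). \<eta> \<in> {-a..a} \<and> x - C2 = F \<eta>} \<union>
         {(x, \<eta>). \<eta> \<in> {0..a} \<and> x - C2 = period C1 / 2 - F \<eta>} \<union>
         {(x, \<eta>). \<eta> \<in> {-a..0} \<and> x - C2 = - period C1 / 2 - F \<eta>}" (is "?L = ?A \<union> ?B \<union> ?C")
  proof (intro equalityI subsetI)
    fix z assume "z \<in> ?L"
    then obtain x where z: "z = (x, ?y x)" and x: "- G pi \<le> x - C2" "x - C2 \<le> G pi"
      using T by auto
    obtain t where t: "x = C2 + G t" using param by blast
    have zt: "z = (x, a * sin t)" and xt: "x - C2 = G t" using y z t by simp_all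
    have "G (- pi) \<le> G t" "G t \<le> G pi" using x t by (simp_all add: minus)
    then have "- pi \<le> t" "t \<le> pi" by (simp_all add: mono)
    then consider "\<bar>t\<bar> \<le> pi/2" | "pi/2 \<le> t" "t \<le> pi" | "- pi \<le> t" "t \<le> - pi/2" by linarith
    then show "z \<in> ?A \<union> ?B \<union> ?C"
    proof cases
      case 1
      then have "z \<in> ?A" using F[of t] range[of t] xt by (simp add: zt)
      then show ?thesis by blast
    next
      case 2
      have "0 \<le> a * sin t" using sin_ge_zero[of t] 2 a by simp
      then have "z \<in> ?B" using F[of "pi - t"] range[of t] 2 pi_minus[of t] T xt by (simp add: zt)
      then show ?thesis by blast
    next
      case 3
      have "a * sin t \<le> 0" using sin_ge_zero[of "- t"] 3 a by (simp add: mult_le_0_iff)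
      moreover have "G (- pi - t) = - G pi - G t"
        using minus[of "pi + t"] add_pi[of t] by (simp add: add.commute)
      moreover have "sin (- pi - t) = sin t" by (simp add: sin_diff)
      ultimately have "z \<in> ?C" using F[of "- pi - t"] range[of t] 3 T xt by (simp add: zt)
      then show ?thesis by blast
    qed
  next
    have inL: "(x, a * sin t) \<in> ?L" if "x = C2 + G t" "- pi \<le> t" "t \<le> pi" for x t
    proof -
      have "G (- pi) \<le> G t" "G t \<le> G pi" using that by (simp_all only: mono)
      then have "x - C2 \<in> {- period C1 / 2..period C1 / 2}" using that(1) T by (simp add: minus)
      moreover have "?y x = a * sin t" using y that(1) by simp
      ultimately show ?thesis by (intro CollectI exI[of _ x]) simp
    qed
    fix z assume "z \<in> ?A \<union> ?B \<union> ?C"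
    then consider "z \<in> ?A" | "z \<in> ?B" | "z \<in> ?C" by blast
    then show "z \<in> ?L"
    proof cases
      case 1
      then obtain x \<eta> where z: "z = (x, \<eta>)" and \<eta>: "\<eta> \<in> {-a..a}" "x - C2 = F \<eta>" by blast
      obtain t where t: "\<eta> = a * sin t" "\<bar>t\<bar> \<le> pi/2" using amp[OF \<eta>(1)] by blast
      have "x = C2 + G t" using \<eta>(2) F[OF t(2)] t(1) by simp
      then show ?thesis using inL[of x t] t by (simp add: z)
    next
      case 2
      then obtain x \<eta> where z: "z = (x, \<eta>)" and \<eta>: "\<eta> \<in> {0..a}" "x - C2 = period C1 / 2 - F \<eta>" by blast
      have "\<eta> \<in> {-a..a}" "0 \<le> \<eta>" using \<eta>(1) a by simp_all
      then obtain t where t: "\<eta> = a * sin t" "\<bar>t\<bar> \<le> pi/2" "0 \<le> t" using amp by blast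
      have "x = C2 + G (pi - t)" using \<eta>(2) F[OF t(2)] t(1) T pi_minus by simp
      then show ?thesis using inL[of x "pi - t"] t by (simp add: z)
    next
      case 3
      then obtain x \<eta> where z: "z = (x, \<eta>)" and \<eta>: "\<eta> \<in> {-a..0}" "x - C2 = - period C1 / 2 - F \<eta>" by blast
      have "\<eta> \<in> {-a..a}" "\<eta> \<le> 0" using \<eta>(1) a by simp_all
      then obtain t where t: "\<eta> = a * sin t" "\<bar>t\<bar> \<le> pi/2" "t \<le> 0" using amp by blast
      have "G (- pi - t) = - G pi - G t"
        using minus[of "pi + t"] add_pi[of t] by (simp add: add.commute)
      then have "x = C2 + G (- pi - t)" using \<eta>(2) F[OF t(2)] t(1) T by simp
      moreover have "sin (- pi - t) = sin t" by (simp add: sin_diff)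
      ultimately show ?thesis using inL[of x "- pi - t"] t by (simp add: z)
    qed
  qed
  then show ?thesis
    unfolding periodic_profile_def Let_def F_def a_def[symmetric] using per by simp
qed

lemma periodic_eqI:
  fixes y z :: "real \<Rightarrow> 'a"
  assumes "T > 0" and y: "\<And>x. y (x + T) = y x" and z: "\<And>x. z (x + T) = z x"
    and eq: "\<And>x. x - c \<in> {-T/2..T/2} \<Longrightarrow> y x = z x"
  shows "y = z"
proof
  fix x
  interpret y: periodic_fun_simple y T by standard (rule y)
  interpret z: periodic_fun_simple z T by standard (rule z)
  \<comment> \<open>rounding (x - c) / T to a nearest integer moves x into the window of length T around c\<close>
  define n where "n = \<lfloor>(x - c) / T + 1/2\<rfloor>"
  have "of_int n \<le> (x - c) / T + 1/2" "(x - c) / T + 1/2 \<le> of_int n + 1"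
    unfolding n_def by linarith+
  then have "(x - of_int n * T) - c \<in> {-T/2..T/2}"
    using \<open>T > 0\<close> by (simp add: field_simps)
  from eq[OF this] show "y x = z x"
    by (simp add: y.minus_of_int z.minus_of_int)
qed

text \<open>The set equation determines the function on a closed period window, periodicity determines
  it elsewhere; the oscillation is therefore the only profile.\<close>

lemma periodic_profile_iff:
  assumes "C1 > 0"
  shows "periodic_profile C1 C2 y \<longleftrightarrow> y = (\<lambda>x. oscillation (amplitude C1) (x - C2))"
proof
  let ?w = "\<lambda>x. oscillation (amplitude C1) (x - C2)"
  have w: "periodic_profile C1 C2 ?w" by (rule periodic_profile_oscillation[OF assms])
  assume y: "periodic_profile C1 C2 y"
  have "angle_time (amplitude C1) 0 < angle_time (amplitude C1) pi"
    by (intro strict_monoD[OF strict_mono_angle_time] amplitude_pos assms) simp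
  then have "period C1 > 0"
    by (simp add: period_eq[OF assms] angle_time_0)
  then show "y = ?w"
  proof (rule periodic_eqI)
    fix x assume x: "x - C2 \<in> {- period C1 / 2..period C1 / 2}"
    have "{(x, y x) |x. x - C2 \<in> {- period C1 / 2..period C1 / 2}} =
        {(x, ?w x) |x. x - C2 \<in> {- period C1 / 2..period C1 / 2}}"
      using y w unfolding periodic_profile_def Let_def by metis
    moreover have "(x, y x) \<in> {(x, y x) |x. x - C2 \<in> {- period C1 / 2..period C1 / 2}}"
      using x by blast
    ultimately show "y x = ?w x" by blast
  qed (use y w in \<open>auto simp: periodic_profile_def Let_def\<close>)
qed (use periodic_profile_oscillation[OF assms] in simp)

section \<open>Maximal solutions\<close>

lemma solution_vertical_everywhere:
  assumes "solution_curve height_matrix I Y" "a \<in> I" "b \<in> I" "vderiv (\<lambda>t. Y t $ 1) a = 0"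
  shows "vderiv (\<lambda>t. Y t $ 1) b = 0"
  by (rule tangent_stays_vertical[OF solution_curve_interval(2) solution_curve_DERIV(3)
      solution_curve_DERIV(2) solution_curve_DERIV(4) solution_curve_ODE, OF assms(1) assms(1) _ assms(1) _
      assms(1) _ assms(1) _ assms(1) _ assms(2,4,3)])

lemma solution_inj_on_coordinate:
  assumes Y: "solution_curve height_matrix I Y"
    and i: "i = 1 \<or> i = (2::2)" and nz: "\<And>u. u \<in> I \<Longrightarrow> vderiv (\<lambda>t. Y t $ i) u \<noteq> 0"
  shows "inj_on (\<lambda>t. Y t $ i) I"
  by (rule inj_on_if_deriv_nonzero[OF solution_curve_interval(2)[OF Y] _ nz])
    (use i solution_curve_DERIV(1,2)[OF Y] in blast)

lemma reparametrization_coordinate_vderiv: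
  assumes Z: "solution_curve height_matrix L Z" and "K \<subseteq> L"
    and I: "open I" and \<phi>: "smooth_on I \<phi>" "bij_betw \<phi> I K"
    and Y: "\<And>u. u \<in> I \<Longrightarrow> Y u = Z (\<phi> u)" and u: "u \<in> I"
  shows "vderiv (\<lambda>t. Y t $ 1) u = vderiv (\<lambda>t. Z t $ 1) (\<phi> u) * vderiv \<phi> u"
proof -
  have "\<phi> u \<in> L" using \<phi>(2) u \<open>K \<subseteq> L\<close> by (auto simp: bij_betw_def)
  have "((\<lambda>t. Y t $ 1) has_real_derivative vderiv (\<lambda>t. Z t $ 1) (\<phi> u) * vderiv \<phi> u) (at u)"
    by (rule has_field_derivative_transform_within_open[OF
        DERIV_chain2[OF solution_curve_DERIV(1)[OF Z \<open>\<phi> u \<in> L\<close>] smooth_on_DERIV[OF \<phi>(1) u]] I u])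
      (simp add: Y)
  then show ?thesis
    by (simp add: has_real_derivative_iff_has_vector_derivative vector_derivative_at)
qed

text \<open>The argument common to vertical lines and graphs, for which \<open>i\<close> is the height and the
  abscissa: a point of an extension shares its coordinate with some point of \<open>Y\<close>, and injectivity
  identifies the two parameters.\<close>

lemma maximal_if_coordinate_onto:
  assumes Y: "solution_curve height_matrix I Y"
    and onto: "(\<lambda>t. Y t $ i) ` I = UNIV"
    and inj: "\<And>L Z K \<phi>. solution_curve height_matrix L Z \<Longrightarrow> K \<subseteq> L \<Longrightarrow> smooth_on I \<phi> \<Longrightarrow>
      \<forall>u\<in>I. vderiv \<phi> u \<noteq> 0 \<Longrightarrow> bij_betw \<phi> I K \<Longrightarrow> \<forall>u\<in>I. Y u = Z (\<phi> u) \<Longrightarrow>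
      inj_on (\<lambda>t. Z t $ i) L"
  shows "maximal_solution height_matrix I Y"
  unfolding maximal_solution_def
proof (intro conjI allI impI Y, elim conjE)
  fix L Z K
  assume Z: "solution_curve height_matrix L Z" "K \<subseteq> L" and R: "reparametrization I Y K Z"
  obtain \<phi> where \<phi>: "smooth_on I \<phi>" "\<forall>u\<in>I. vderiv \<phi> u \<noteq> 0" "bij_betw \<phi> I K" "\<forall>u\<in>I. Y u = Z (\<phi> u)"
    using R unfolding reparametrization_def by (elim conjE exE)
  have Zinj: "inj_on (\<lambda>t. Z t $ i) L" by (rule inj[OF Z \<phi>])
  have "L \<subseteq> K"
  proof
    fix l assume l: "l \<in> L"
    have "Z l $ i \<in> (\<lambda>t. Y t $ i) ` I" unfolding onto by simp
    then obtain u where u: "u \<in> I" "Z l $ i = Y u $ i" by blast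
    have "\<phi> u \<in> K" using \<phi>(3) u(1) by (auto simp: bij_betw_def)
    moreover have "Z l $ i = Z (\<phi> u) $ i" using u \<phi>(4) by simp
    ultimately show "l \<in> K" using inj_onD[OF Zinj] l Z(2) by blast
  qed
  with Z(2) show "K = L" by blast
qed

text \<open>An extension has a non-vertical tangent where it meets \<open>Y\<close>, hence everywhere, so its
  abscissa is injective.\<close>

lemma maximal_graph:
  assumes w: "\<And>t. (w has_real_derivative v t) (at t)"
    and v: "\<And>t. (v has_real_derivative - (w t ^ 3)) (at t)"
    and R: "reparametrization I Y UNIV (\<lambda>t. vector [t, w t])"
  shows "maximal_solution height_matrix I Y"
proof -
  obtain \<psi> where I: "open I" "connected I" and \<psi>: "smooth_on I \<psi>" "\<And>u. u \<in> I \<Longrightarrow> vderiv \<psi> u \<noteq> 0"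
    and onto: "\<psi> ` I = UNIV" and Y: "\<And>u. u \<in> I \<Longrightarrow> Y u = vector [\<psi> u, w (\<psi> u)]"
    using R unfolding reparametrization_def bij_betw_def by blast
  have "I \<noteq> {}" using onto by blast
  have Y': "solution_curve height_matrix I Y"
    by (rule graph_solution(1)[OF I \<open>I \<noteq> {}\<close> \<psi> w v Y])
  have x1: "vderiv (\<lambda>t. Y t $ 1) u = vderiv \<psi> u" if "u \<in> I" for u
    by (rule graph_solution(2)[OF I \<open>I \<noteq> {}\<close> \<psi> w v Y that])
  show ?thesis
  proof (rule maximal_if_coordinate_onto[OF Y', where i = 1])
    show "(\<lambda>t. Y t $ 1) ` I = UNIV" unfolding onto[symmetric] by (rule image_cong) (simp_all add: Y)
    fix L Z K \<phi>
    assume Z: "solution_curve height_matrix L Z" "K \<subseteq> L"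
      and \<phi>: "smooth_on I \<phi>" "\<forall>u\<in>I. vderiv \<phi> u \<noteq> 0" "bij_betw \<phi> I K" "\<forall>u\<in>I. Y u = Z (\<phi> u)"
    obtain u where u: "u \<in> I" using \<open>I \<noteq> {}\<close> by blast
    have L: "\<phi> u \<in> L" using \<phi>(3) u Z(2) by (auto simp: bij_betw_def)
    have "vderiv (\<lambda>t. Z t $ 1) (\<phi> u) \<noteq> 0"
      using reparametrization_coordinate_vderiv[OF Z I(1) \<phi>(1,3) bspec[OF \<phi>(4)] u] x1[OF u] \<psi>(2)[OF u]
      by auto
    then have "vderiv (\<lambda>t. Z t $ 1) l \<noteq> 0" if "l \<in> L" for l
      using solution_vertical_everywhere[OF Z(1) that L] by blast
    then show "inj_on (\<lambda>t. Z t $ 1) L"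
      by (intro solution_inj_on_coordinate[OF Z(1)]) auto
  qed
qed

text \<open>An extension has a vertical tangent somewhere, hence everywhere, so regularity makes its
  height injective.\<close>

lemma maximal_vertical_line:
  assumes R: "reparametrization I Y UNIV (\<lambda>t. vector [C, t])"
  shows "maximal_solution height_matrix I Y"
proof -
  obtain \<psi> where I: "open I" "connected I" and \<psi>: "smooth_on I \<psi>" "\<And>u. u \<in> I \<Longrightarrow> vderiv \<psi> u \<noteq> 0"
    and onto: "\<psi> ` I = UNIV" and Y: "\<And>u. u \<in> I \<Longrightarrow> Y u = vector [C, \<psi> u]"
    using R unfolding reparametrization_def bij_betw_def by blast
  have "I \<noteq> {}" using onto by blast
  have Y': "solution_curve height_matrix I Y"
    by (rule vertical_solution(1)[OF I \<open>I \<noteq> {}\<close> \<psi> Y])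
  have x1: "vderiv (\<lambda>t. Y t $ 1) u = 0" if "u \<in> I" for u
    by (rule vertical_solution(2)[OF I \<open>I \<noteq> {}\<close> \<psi> Y that])
  show ?thesis
  proof (rule maximal_if_coordinate_onto[OF Y', where i = 2])
    show "(\<lambda>t. Y t $ 2) ` I = UNIV" unfolding onto[symmetric] by (rule image_cong) (simp_all add: Y)
    fix L Z K \<phi>
    assume Z: "solution_curve height_matrix L Z" "K \<subseteq> L"
      and \<phi>: "smooth_on I \<phi>" "\<forall>u\<in>I. vderiv \<phi> u \<noteq> 0" "bij_betw \<phi> I K" "\<forall>u\<in>I. Y u = Z (\<phi> u)"
    obtain u where u: "u \<in> I" using \<open>I \<noteq> {}\<close> by blast
    have L: "\<phi> u \<in> L" using \<phi>(3) u Z(2) by (auto simp: bij_betw_def)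
    have "vderiv (\<lambda>t. Z t $ 1) (\<phi> u) = 0"
      using reparametrization_coordinate_vderiv[OF Z I(1) \<phi>(1,3) bspec[OF \<phi>(4)] u] x1[OF u]
        bspec[OF \<phi>(2) u] by simp
    then have "vderiv (\<lambda>t. Z t $ 1) l = 0" if "l \<in> L" for l
      using solution_vertical_everywhere[OF Z(1) L that] by blast
    then have "vderiv (\<lambda>t. Z t $ 2) l \<noteq> 0" if "l \<in> L" for l
      using solution_curve_ODE(1)[OF Z(1) that] that by blast
    then show "inj_on (\<lambda>t. Z t $ 2) L"
      by (intro solution_inj_on_coordinate[OF Z(1)]) auto
  qed
qed

text \<open>A coordinate with nonvanishing derivative is itself an admissible change of parameter.\<close>

lemma reparametrization_by_coordinate:
  assumes Y: "solution_curve height_matrix I Y" and i: "i = 1 \<or> i = (2::2)"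
    and nz: "\<And>u. u \<in> I \<Longrightarrow> vderiv (\<lambda>t. Y t $ i) u \<noteq> 0"
    and Z: "\<And>u. u \<in> I \<Longrightarrow> Y u = Z (Y u $ i)"
  shows "reparametrization I Y ((\<lambda>t. Y t $ i) ` I) Z"
  unfolding reparametrization_def
proof (intro conjI exI[of _ "\<lambda>t. Y t $ i"] ballI)
  show "open I" "connected I"
    using solution_curve_interval[OF Y] by (simp_all add: is_interval_connected_1)
  have "smooth_on I (\<lambda>t. Y t $ 1)" "smooth_on I (\<lambda>t. Y t $ 2)"
    using Y unfolding solution_curve_iff by blast+
  then show "smooth_on I (\<lambda>t. Y t $ i)" using i by (elim disjE) simp_all
  show "bij_betw (\<lambda>t. Y t $ i) I ((\<lambda>t. Y t $ i) ` I)"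
    by (rule bij_betw_imageI[OF solution_inj_on_coordinate[OF Y i nz] refl])
qed (use nz Z in blast)+

lemma maximal_solution_onto:
  assumes "maximal_solution A I Y" "solution_curve A UNIV Z" "reparametrization I Y K Z"
  shows "reparametrization I Y UNIV Z"
proof -
  have "K = UNIV" using assms unfolding maximal_solution_def by blast
  with assms(3) show ?thesis by simp
qed

text \<open>A solution runs inside a vertical line, or it is part of the graph of the global oscillation
  with the same height and slope at one point (the zero function if both vanish). In either case
  the complete curve is a solution that extends it, so by maximality it is all of it.\<close>

lemma maximal_solution_cases:
  assumes max: "maximal_solution height_matrix I Y"
  shows "(\<exists>C. reparametrization I Y UNIV (\<lambda>t. vector [C, t])) \<or>
      reparametrization I Y UNIV (\<lambda>t. vector [t, 0]) \<or>
      (\<exists>C1 C2. C1 > 0 \<and>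
         reparametrization I Y UNIV (\<lambda>t. vector [t, oscillation (amplitude C1) (t - C2)]))"
proof -
  have Y: "solution_curve height_matrix I Y" using max unfolding maximal_solution_def by blast
  note I = solution_curve_interval[OF Y]
  note D = solution_curve_DERIV[OF Y]
  have one: "vderiv (\<lambda>t::real. t) u = 1" for u :: real
    by (rule vector_derivative_at) (rule has_vector_derivative_id)
  obtain a where a: "a \<in> I" using I(3) by blast
  show ?thesis
  proof (cases "vderiv (\<lambda>t. Y t $ 1) a = 0")
    case True
    then have x1: "vderiv (\<lambda>t. Y t $ 1) u = 0" if "u \<in> I" for u
      using solution_vertical_everywhere[OF Y a that] by blast
    then have y1: "vderiv (\<lambda>t. Y t $ 2) u \<noteq> 0" if "u \<in> I" for u
      using solution_curve_ODE(1)[OF Y that] that by blast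
    have x: "Y u $ 1 = Y a $ 1" if "u \<in> I" for u
    proof -
      have "convex I" using I(2) by (simp add: is_interval_convex_1)
      moreover have "((\<lambda>t. Y t $ 1) has_real_derivative 0) (at t within I)" if "t \<in> I" for t
        using has_field_derivative_at_within[OF D(1)[OF that]] unfolding x1[OF that] .
      ultimately obtain c where "\<forall>t\<in>I. Y t $ 1 = c"
        using has_field_derivative_zero_constant[of I "\<lambda>t. Y t $ 1"] by auto
      then show ?thesis using a that by simp
    qed
    have "reparametrization I Y ((\<lambda>t. Y t $ 2) ` I) (\<lambda>t. vector [Y a $ 1, t])"
      by (rule reparametrization_by_coordinate[OF Y _ y1]) (simp_all add: vec_eq_iff forall_2 x)
    moreover have "solution_curve height_matrix UNIV (\<lambda>t. vector [Y a $ 1, t])"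
      by (rule vertical_solution(1)[OF _ _ _ smooth_on_ident]) (simp_all add: one)
    ultimately show ?thesis using maximal_solution_onto[OF max] by blast
  next
    case False
    then have x1: "vderiv (\<lambda>t. Y t $ 1) u \<noteq> 0" if "u \<in> I" for u
      using solution_vertical_everywhere[OF Y that a] by blast
    have graph: "reparametrization I Y UNIV (\<lambda>t. vector [t, w t])"
      if w: "\<And>t. (w has_real_derivative v t) (at t)"
        and v: "\<And>t. (v has_real_derivative - (w t ^ 3)) (at t)"
        and init: "w (Y a $ 1) = Y a $ 2"
          "v (Y a $ 1) = vderiv (\<lambda>t. Y t $ 2) a / vderiv (\<lambda>t. Y t $ 1) a" for w v
    proof -
      have y: "Y u $ 2 = w (Y u $ 1)" if "u \<in> I" for u
        by (rule graph_unique[OF I(2) D(1) D(3) D(2) D(4) x1 solution_curve_ODE(2)[OF Y] w v a init that])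
      have "reparametrization I Y ((\<lambda>t. Y t $ 1) ` I) (\<lambda>t. vector [t, w t])"
        by (rule reparametrization_by_coordinate[OF Y _ x1]) (simp_all add: vec_eq_iff forall_2 y)
      moreover have "solution_curve height_matrix UNIV (\<lambda>t. vector [t, w t])"
        by (rule graph_solution(1)[OF _ _ _ smooth_on_ident _ w v]) (simp_all add: one)
      ultimately show ?thesis using maximal_solution_onto[OF max] by blast
    qed
    define p where "p = vderiv (\<lambda>t. Y t $ 2) a / vderiv (\<lambda>t. Y t $ 1) a"
    \<comment> \<open>the conserved energy of the oscillator, which fixes the amplitude\<close>
    define C1 where "C1 = p\<^sup>2 + (Y a $ 2) ^ 4 / 2"
    show ?thesis
    proof (cases "C1 = 0")
      case True
      then have "p = 0" "Y a $ 2 = 0"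
        by (simp_all add: C1_def add_nonneg_eq_0_iff)
      then have "reparametrization I Y UNIV (\<lambda>t. vector [t, 0])"
        by (intro graph[where v = "\<lambda>t. 0"]) (simp_all add: p_def)
      then show ?thesis by blast
    next
      case False
      then have C1: "C1 > 0" by (simp add: C1_def order_less_le)
      define b where "b = amplitude C1"
      have b: "b > 0" "b ^ 4 = 2 * p\<^sup>2 + (Y a $ 2) ^ 4"
        using amplitude_pos[OF C1] amplitude_pow4[OF C1] by (simp_all add: b_def C1_def)
      obtain c where c: "oscillation b c = Y a $ 2" "velocity b c = p"
        using oscillation_phase[OF b] by blast
      \<comment> \<open>the translation that moves the phase c to the abscissa of the chosen point\<close>
      define C2 where "C2 = Y a $ 1 - c"
      have "reparametrization I Y UNIV (\<lambda>t. vector [t, oscillation b (t - C2)])"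
      proof (rule graph[where v = "\<lambda>t. velocity b (t - C2)"])
        show "((\<lambda>t. oscillation b (t - C2)) has_real_derivative velocity b (t - C2)) (at t)" for t
          using DERIV_chain2[OF oscillation_DERIV[OF b(1)] DERIV_diff[OF DERIV_ident DERIV_const]] by simp
        show "((\<lambda>t. velocity b (t - C2)) has_real_derivative - (oscillation b (t - C2) ^ 3)) (at t)" for t
          using DERIV_chain2[OF velocity_DERIV[OF b(1)] DERIV_diff[OF DERIV_ident DERIV_const]] by simp
      qed (simp_all add: C2_def c flip: p_def)
      with C1 show ?thesis unfolding b_def by blast
    qed
  qed
qed

theorem theorem3p4:
  "(\<forall>C1 C2. C1 > 0 \<longrightarrow> (\<exists>!y. periodic_profile C1 C2 y)) \<and>
   (\<forall>I Y. maximal_solution (vector [vector [0, 0], vector [0, -1]]) I Y \<longleftrightarrow>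
      (\<exists>C. reparametrization I Y UNIV (\<lambda>t. vector [C, t])) \<or>
      reparametrization I Y UNIV (\<lambda>t. vector [t, 0]) \<or>
      (\<exists>C1 C2 y. C1 > 0 \<and> periodic_profile C1 C2 y \<and>
         reparametrization I Y UNIV (\<lambda>t. vector [t, y t])))"
proof (intro conjI allI impI iffI)
  show "\<exists>!y. periodic_profile C1 C2 y" if "C1 > 0" for C1 C2
    unfolding periodic_profile_iff[OF that] by simp
next
  fix I Y assume "maximal_solution height_matrix I Y"
  from maximal_solution_cases[OF this]
  show "(\<exists>C. reparametrization I Y UNIV (\<lambda>t. vector [C, t])) \<or>
      reparametrization I Y UNIV (\<lambda>t. vector [t, 0]) \<or>
      (\<exists>C1 C2 y. C1 > 0 \<and> periodic_profile C1 C2 y \<and>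
         reparametrization I Y UNIV (\<lambda>t. vector [t, y t]))"
    using periodic_profile_oscillation by blast
next
  fix I Y
  assume "(\<exists>C. reparametrization I Y UNIV (\<lambda>t. vector [C, t])) \<or>
      reparametrization I Y UNIV (\<lambda>t. vector [t, 0]) \<or>
      (\<exists>C1 C2 y. C1 > 0 \<and> periodic_profile C1 C2 y \<and>
         reparametrization I Y UNIV (\<lambda>t. vector [t, y t]))"
  then show "maximal_solution height_matrix I Y"
  proof (elim disjE exE conjE)
    fix C assume "reparametrization I Y UNIV (\<lambda>t. vector [C, t])"
    then show ?thesis by (rule maximal_vertical_line)
  next
    assume "reparametrization I Y UNIV (\<lambda>t. vector [t, 0])"
    then show ?thesis by (intro maximal_graph[where w = "\<lambda>t. 0" and v = "\<lambda>t. 0"]) simp_all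
  next
    fix C1 C2 y
    assume C1: "0 < C1" and y: "periodic_profile C1 C2 y"
      and R: "reparametrization I Y UNIV (\<lambda>t. vector [t, y t])"
    let ?a = "amplitude C1"
    have a: "?a > 0" by (rule amplitude_pos[OF C1])
    have y: "y = (\<lambda>t. oscillation ?a (t - C2))" using y unfolding periodic_profile_iff[OF C1] .
    show ?thesis
    proof (rule maximal_graph[where v = "\<lambda>t. velocity ?a (t - C2)", OF _ _ R])
      show "(y has_real_derivative velocity ?a (t - C2)) (at t)" for t
        using DERIV_chain2[OF oscillation_DERIV[OF a] DERIV_diff[OF DERIV_ident DERIV_const]]
        by (simp add: y)
      show "((\<lambda>t. velocity ?a (t - C2)) has_real_derivative - (y t ^ 3)) (at t)" for t
        using DERIV_chain2[OF velocity_DERIV[OF a] DERIV_diff[OF DERIV_ident DERIV_const]]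
        by (simp add: y)
    qed
  qed
qed

end
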